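(* Let $$p(x) = \frac{4\lambda( 1 - \lambda ) x^2}{( 1 - x^2 )^{2}} + \frac{2\lambda}{1 - x^2} + \frac{\mu\pi^2}{4} + \frac{\mu(1 - \mu) \pi^2}{4} \tan^2\!\left(\frac{\pi x}{2}\right) - \frac{2 \mu \lambda \pi x \tan(\pi x /2)}{1 - x^2}$$ and let the real numbers $\lambda, \mu$ satisfy $$\lambda \ge 0, \quad \mu \ge 0, \quad \frac12 \le \lambda + \mu \le 1, \quad \frac{1 - \mu}{2} \le \lambda \le 1 - \mu .$$ If $f$ is an analytic function in $\Delta$ satisfying $$| Sf(z) | \le 2 p( |z| ) , \qquad z \in \Delta ,$$ then $f$ is univalent in $\Delta$. Also, $$f(z) = \int_0^z \frac{dt} { (1 - t^2)^{2\lambda} \cos^{2\mu}( \pi t/2 ) }$$ is an odd univalent function in $\Delta$. Moreover, the univalence criterion $|Sf(z)|\le 2p(|z|)$, $z\in\Delta$, is sharp.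
   Context: $\Delta=\{z\in\mathbb{C}: |z|<1\}$ is the open unit disc. For an analytic locally univalent function $f$, the Schwarzian derivative is $Sf = \left(\frac{f''}{f'}\right)' - \frac12\left(\frac{f''}{f'}\right)^2$; a hypothesis on $Sf$ in $\Delta$ presupposes that $f$ is locally univalent in $\Delta$. Univalent means injective. The formula for $p$ is also used for complex argument $z\in\Delta$. The univalence criterion $|Sf(z)|\le 2p(|z|)$, $z\in\Delta$, is called sharp if, for analytic (locally univalent) $f$ in $\Delta$, the conditions $Sf(x)\ge 2p(x)$ for $-1<x<1$ (in particular $Sf(x)$ is real there) and $Sf(z)\not\equiv 2p(z)$ imply that $f$ is not univalent in $\Delta$. The powers $(1-t^2)^{2\lambda}$ and $\cos^{2\mu}(\pi t/2)$ denote the analytic branches in $\Delta$ equal to $1$ at $t=0$. *)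

theory Defs
  imports "HOL-Complex_Analysis.Complex_Analysis"
begin

abbreviation unit_disc :: "complex set" where
  "unit_disc \<equiv> ball 0 1"

definition schwarzian :: "(complex \<Rightarrow> complex) \<Rightarrow> complex \<Rightarrow> complex" where
  "schwarzian f z =
     deriv (\<lambda>w. deriv (deriv f) w / deriv f w) z - 1 / 2 * (deriv (deriv f) z / deriv f z)\<^sup>2"

definition locally_univalent_on :: "(complex \<Rightarrow> complex) \<Rightarrow> complex set \<Rightarrow> bool" where
  "locally_univalent_on f S \<longleftrightarrow> (\<forall>z\<in>S. \<exists>U. open U \<and> z \<in> U \<and> U \<subseteq> S \<and> inj_on f U)"

text \<open>The type is polymorphic because the same formula is used both for real arguments (in the
  bound on the Schwarzian) and for complex arguments (in the definition of sharpness).\<close>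

definition nehari_p :: "real \<Rightarrow> real \<Rightarrow> 'a::{real_normed_field,banach} \<Rightarrow> 'a" where
  "nehari_p lam mu x =
     of_real (4 * lam * (1 - lam)) * x\<^sup>2 / (1 - x\<^sup>2)\<^sup>2
     + of_real (2 * lam) / (1 - x\<^sup>2)
     + of_real (mu * pi\<^sup>2 / 4)
     + of_real (mu * (1 - mu) * pi\<^sup>2 / 4) * (tan (of_real pi * x / 2))\<^sup>2
     - of_real (2 * mu * lam * pi) * x * tan (of_real pi * x / 2) / (1 - x\<^sup>2)"

definition univalence_bound :: "real \<Rightarrow> real \<Rightarrow> (complex \<Rightarrow> complex) \<Rightarrow> bool" where
  "univalence_bound lam mu f \<longleftrightarrow>
     (\<forall>z\<in>unit_disc. cmod (schwarzian f z) \<le> 2 * nehari_p lam mu (cmod z))"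

definition sharp_criterion :: "real \<Rightarrow> real \<Rightarrow> bool" where
  "sharp_criterion lam mu \<longleftrightarrow>
     (\<forall>f. f holomorphic_on unit_disc \<and> locally_univalent_on f unit_disc \<and>
          (\<forall>x::real. -1 < x \<and> x < 1 \<longrightarrow>
             schwarzian f (of_real x) \<in> \<real> \<and>
             Re (schwarzian f (of_real x)) \<ge> 2 * nehari_p lam mu x) \<and>
          (\<exists>z\<in>unit_disc. schwarzian f z \<noteq> 2 * nehari_p lam mu z)
        \<longrightarrow> \<not> inj_on f unit_disc)"

text \<open>On the unit disc both \<open>1 - t\<^sup>2\<close> and \<open>cos (\<pi> t / 2)\<close> have positive real part, so the
  principal powers are the analytic branches with value 1 at the origin; see
  \<open>extremal_branches\<close> below.\<close>

definition extremal_integrand :: "real \<Rightarrow> real \<Rightarrow> complex \<Rightarrow> complex" where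
  "extremal_integrand lam mu t =
     1 / ((1 - t\<^sup>2) powr of_real (2 * lam) * cos (of_real pi * t / 2) powr of_real (2 * mu))"

definition extremal_fun :: "real \<Rightarrow> real \<Rightarrow> complex \<Rightarrow> complex" where
  "extremal_fun lam mu z = contour_integral (linepath 0 z) (extremal_integrand lam mu)"

lemma Re_one_minus_square_pos:
  fixes t :: complex
  assumes "t \<in> unit_disc"
  shows "Re (1 - t\<^sup>2) > 0"
proof -
  have "cmod (t\<^sup>2) < 1"
    using assms by (simp add: norm_power power_less_one_iff)
  with complex_Re_le_cmod[of "t\<^sup>2"] show ?thesis
    by simp
qed

lemma Re_cos_half_pi_pos:
  fixes t :: complex
  assumes "t \<in> unit_disc"
  shows "Re (cos (of_real pi * t / 2)) > 0"
proof -
  have "\<bar>Re t\<bar> < 1"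
    using assms abs_Re_le_cmod[of t] by simp
  hence "- 1 < Re t" "Re t < 1" by auto
  hence "cos (pi * Re t / 2) > 0"
    using mult_strict_left_mono[of "- 1" "Re t" pi] mult_strict_left_mono[of "Re t" 1 pi]
    by (intro cos_gt_zero_pi) auto
  moreover have "exp (pi * Im t / 2) + exp (- (pi * Im t / 2)) > 0"
    by (intro add_pos_pos exp_gt_zero)
  ultimately show ?thesis
    by (simp add: Re_cos)
qed

lemma extremal_branches:
  "(\<lambda>t. (1 - t\<^sup>2) powr of_real a) holomorphic_on unit_disc"
  "(\<lambda>t. cos (of_real pi * t / 2) powr of_real a) holomorphic_on unit_disc"
  "(1 - 0\<^sup>2 :: complex) powr of_real a = 1"
  "cos (of_real pi * 0 / 2 :: complex) powr of_real a = 1"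
proof -
  have "1 - t\<^sup>2 \<notin> \<real>\<^sub>\<le>\<^sub>0" "cos (of_real pi * t / 2) \<notin> \<real>\<^sub>\<le>\<^sub>0" if "t \<in> unit_disc" for t :: complex
    using Re_one_minus_square_pos[OF that] Re_cos_half_pi_pos[OF that]
    by (auto simp: complex_nonpos_Reals_iff)
  thus "(\<lambda>t. (1 - t\<^sup>2) powr of_real a) holomorphic_on unit_disc"
    "(\<lambda>t. cos (of_real pi * t / 2) powr of_real a) holomorphic_on unit_disc"
    by (auto intro!: holomorphic_intros)
qed auto

end

theory Submission imports Defs begin

text \<open>The function \<open>p\<close> is built so that \<open>y(x) = (1 - x\<^sup>2)\<^sup>\<lambda> cos\<^sup>\<mu> (\<pi>x/2)\<close> is a positive solution of
  \<open>y'' + p y = 0\<close> on \<open>(-1, 1)\<close>; equivalently, \<open>U = - y'/y\<close> satisfies the Riccati equation \<open>U' = p + U\<^sup>2\<close>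
  (\<open>nehari_slope_derivative\<close>). All three claims are comparisons of \<open>y\<close> with solutions of
  \<open>u'' + (Sf/2) u = 0\<close>, whose solutions are \<open>(A + B f) (f')\<^bsup>-1/2\<^esup>\<close>, so that two points
  with the same value of \<open>f\<close> are two zeros of one solution.

  Univalence is Nehari's argument. If \<open>f\<close> takes the same value at two points, join them by a
  hyperbolic line and pull the equation back to \<open>(-1, 1)\<close>, with parameter \<open>0\<close> at the point of the line
  that is closest to the origin. The bound \<open>2 p(|z|)\<close> for \<open>|Sf|\<close> survives the pull-back because
  \<open>(1 - x\<^sup>2)\<^sup>2 p(x)\<close> is nonincreasing (\<open>nehari_p_weighted_antimono\<close>). A solution with two zeros
  then contradicts the existence of the positive solution \<open>y\<close> (\<open>comparison_excludes_two_zeros\<close>).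

  The extremal function has derivative \<open>1 / y\<^sup>2\<close> and Schwarzian \<open>2 p(z)\<close>. It satisfies the criterion
  because \<open>|p(z)| \<le> p(|z|)\<close> (\<open>norm_nehari_p_le\<close>). Both this inequality and the monotonicity are read off
  from the partial fractions of \<open>tan (\<pi>x/2)\<close>: after splitting off the poles \<open>\<plusminus>1\<close>, what remains of the
  tangent is a positive series that is almost constant on the interval, and \<open>p\<close> becomes a combination
  of positive terms with nonnegative coefficients.

  For sharpness suppose \<open>Sf \<ge> 2 p\<close> on the axis, with strict inequality at \<open>x0\<close>. The solution that has the
  logarithmic derivative of \<open>y\<close> at \<open>x0\<close> must vanish on each side of \<open>x0\<close>, because \<open>1 / y\<^sup>2\<close> is not
  integrable at \<open>\<plusminus>1\<close>; here \<open>\<lambda> + \<mu> \<ge> 1/2\<close> enters (\<open>comparison_forces_zero\<close>). These two zeros are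
  two points with the same value of \<open>f\<close>.\<close>

section \<open>The partial fraction expansion of the tangent\<close>

text \<open>With \<open>w = x\<^sup>2\<close> this is what is left of
  \<open>(\<pi>/2) tan (\<pi>x/2) / x = \<Sum>\<^bsub>k odd\<^esub> 2 / (k\<^sup>2 - x\<^sup>2)\<close> after the poles \<open>\<plusminus>1\<close> on the unit circle
  have been removed. It is analytic beyond the closed disc and nearly constant there.\<close>

definition odd_tail :: "'a::{real_normed_field,banach} \<Rightarrow> 'a" where
  "odd_tail w = (\<Sum>n. 2 / ((2 * of_nat n + 3)\<^sup>2 - w))"

text \<open>The logarithmic derivative of the reflection formula
  \<open>\<Gamma>(z) \<Gamma>(1 - z) = \<pi> / sin (\<pi>z)\<close>. It is the source of the partial fractions of the tangent.\<close>

lemma Digamma_reflection: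
  fixes z :: complex
  assumes "z \<notin> \<int>"
  shows "Digamma (1 - z) - Digamma z = of_real pi * cot (of_real pi * z)"
proof -
  have nz: "z \<notin> \<int>\<^sub>\<le>\<^sub>0"
    using assms nonpos_Ints_subset_Ints by blast
  have "1 - z \<notin> \<int>"
    using assms Ints_1 Ints_diff[of 1 "1 - z"] by auto
  then have nz': "1 - z \<notin> \<int>\<^sub>\<le>\<^sub>0"
    using nonpos_Ints_subset_Ints by blast
  have s: "sin (of_real pi * z) \<noteq> 0"
  proof
    assume "sin (of_real pi * z) = 0"
    then obtain n where "of_real pi * z = of_real (of_int n * pi)"
      by (auto simp: sin_eq_0)
    then have "z = of_int n" by simp
    with assms show False by auto
  qed
  have "((\<lambda>z. Gamma z * Gamma (1 - z)) has_field_derivative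
        Gamma z * Gamma (1 - z) * (Digamma z - Digamma (1 - z))) (at z)"
    by (rule derivative_eq_intros refl nz nz')+ (simp add: algebra_simps)
  moreover have "((\<lambda>z. Gamma z * Gamma (1 - z)) has_field_derivative
        - (of_real pi)\<^sup>2 * cos (of_real pi * z) / (sin (of_real pi * z))\<^sup>2) (at z)"
    unfolding Gamma_reflection_complex using s
    by (auto intro!: derivative_eq_intros simp: power2_eq_square)
  ultimately have "Gamma z * Gamma (1 - z) * (Digamma z - Digamma (1 - z)) =
      - (of_real pi)\<^sup>2 * cos (of_real pi * z) / (sin (of_real pi * z))\<^sup>2"
    by (rule DERIV_unique)
  then have "of_real pi * sin (of_real pi * z) *
      ((Digamma (1 - z) - Digamma z) * sin (of_real pi * z)) =
      of_real pi * sin (of_real pi * z) * (of_real pi * cos (of_real pi * z))"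
    unfolding Gamma_reflection_complex using s
    by (simp add: field_simps power2_eq_square)
  then have "(Digamma (1 - z) - Digamma z) * sin (of_real pi * z) = of_real pi * cos (of_real pi * z)"
    using s by (subst (asm) mult_left_cancel) auto
  then show ?thesis
    using s by (simp add: cot_def field_simps)
qed

text \<open>At \<open>(1 - z)/2\<close> the cotangent in the reflection formula is \<open>tan (\<pi>z/2)\<close>, and subtracting the
  series of the two Digamma values pairs the poles at \<open>\<plusminus>(2n + 1)\<close>. The pair with \<open>n = 0\<close> is split off.\<close>

lemma half_pi_tan_expansion:
  fixes z :: complex
  assumes z: "z \<in> unit_disc"
  shows "of_real (pi / 2) * tan (of_real pi * z / 2) = 2 * z / (1 - z\<^sup>2) + z * odd_tail (z\<^sup>2)"
proof -
  have re: "\<bar>Re z\<bar> < 1"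
    using z abs_Re_le_cmod[of z] by simp
  define a where "a = (1 - z) / 2"
  have a: "Re a > 0" "Re a < 1" "1 - a = (1 + z) / 2" "Re (1 - a) > 0"
    using re by (auto simp: a_def field_simps)
  have "a \<notin> \<int>"
    using a by (auto elim!: Ints_cases)
  have ne: "a \<noteq> 0" "1 - a \<noteq> 0"
    using a(1,4) by force+
  have pole_pair: "inverse (a + of_nat n) - inverse (1 - a + of_nat n) =
      4 * z / ((2 * of_nat n + 1)\<^sup>2 - z\<^sup>2)" for n
  proof -
    have "Re (a + of_nat n) > 0" "Re (1 - a + of_nat n) > 0"
      using a(1,4) by auto
    then have "a + of_nat n \<noteq> 0" "1 - a + of_nat n \<noteq> 0" by force+
    then have nz: "2 * of_nat n + 1 - z \<noteq> 0" "2 * of_nat n + 1 + z \<noteq> 0"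
      by (auto simp: a_def field_simps)
    have eq: "a + of_nat n = (2 * of_nat n + 1 - z) / 2" "1 - a + of_nat n = (2 * of_nat n + 1 + z) / 2"
      by (auto simp: a_def field_simps)
    have "inverse (a + of_nat n) - inverse (1 - a + of_nat n) =
        4 * z / ((2 * of_nat n + 1 - z) * (2 * of_nat n + 1 + z))"
      unfolding eq using nz by (simp add: field_simps)
    also have "(2 * of_nat n + 1 - z) * (2 * of_nat n + 1 + z) = (2 * of_nat n + 1)\<^sup>2 - z\<^sup>2"
      by (simp add: algebra_simps power2_eq_square)
    finally show ?thesis .
  qed
  have "(\<lambda>n. (inverse (of_nat (Suc n)) - inverse (1 - a + of_nat n))
           - (inverse (of_nat (Suc n)) - inverse (a + of_nat n))) sums
        ((Digamma (1 - a) + euler_mascheroni) - (Digamma a + euler_mascheroni))"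
    using summable_Digamma[OF ne(1)] summable_Digamma[OF ne(2)]
    by (intro sums_diff) (auto simp: Digamma_def summable_sums)
  then have "(\<lambda>n. 4 * z / ((2 * of_nat n + 1)\<^sup>2 - z\<^sup>2)) sums (Digamma (1 - a) - Digamma a)"
    by (simp add: pole_pair)
  also have "Digamma (1 - a) - Digamma a = of_real pi * cot (of_real pi * a)"
    by (rule Digamma_reflection) fact
  also have "of_real pi * a = of_real pi / 2 - of_real pi * z / 2"
    by (simp add: a_def right_diff_distrib diff_divide_distrib)
  also have "cot \<dots> = tan (of_real pi * z / 2)"
    by (simp only: cot_def tan_def sin_cos_eq[of "of_real pi * z / 2"] cos_sin_eq[of "of_real pi * z / 2"])
  finally have "(\<lambda>n. 1/2 * (4 * z / ((2 * of_nat n + 1)\<^sup>2 - z\<^sup>2))) sums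
      (1/2 * (of_real pi * tan (of_real pi * z / 2)))"
    by (rule sums_mult)
  then have S: "(\<lambda>n. 2 * z / ((2 * of_nat n + 1)\<^sup>2 - z\<^sup>2)) sums (of_real (pi/2) * tan (of_real pi * z / 2))"
    by simp
  then have S': "(\<lambda>n. 2 * z / ((2 * of_nat n + 3)\<^sup>2 - z\<^sup>2)) sums
      (of_real (pi/2) * tan (of_real pi * z / 2) - 2 * z / (1 - z\<^sup>2))"
    using sums_Suc_iff[of "\<lambda>n. 2 * z / ((2 * of_nat n + 1)\<^sup>2 - z\<^sup>2)"
        "of_real (pi/2) * tan (of_real pi * z / 2) - 2 * z / (1 - z\<^sup>2)"]
    by (simp add: add.commute algebra_simps)
  show ?thesis
  proof (cases "z = 0")
    case False
    have "(\<lambda>n. 2 * z / ((2 * of_nat n + 3)\<^sup>2 - z\<^sup>2) / z) sums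
      ((of_real (pi/2) * tan (of_real pi * z / 2) - 2 * z / (1 - z\<^sup>2)) / z)"
      by (rule sums_divide[OF S'])
    then have "odd_tail (z\<^sup>2) = (of_real (pi/2) * tan (of_real pi * z / 2) - 2 * z / (1 - z\<^sup>2)) / z"
      using False by (simp add: odd_tail_def sums_iff)
    with False show ?thesis by simp
  qed auto
qed

text \<open>The denominators are \<open>4 (n + 1) (n + 2)\<close>, so the series telescopes. This is the value of the
  tail at the boundary, and a summable majorant on the whole closed disc.\<close>

lemma odd_tail_sums_one: "(\<lambda>n. 2 / ((2 * of_nat n + 3)\<^sup>2 - 1 :: real)) sums (1 / 2)"
proof -
  have "(\<lambda>n. 1 / 2 * (inverse (1 + real n) - inverse (1 + real (Suc n)))) sums (1 / 2 * (inverse (1 + real 0) - 0))"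
    by (intro sums_mult telescope_sums'[OF filterlim_compose[OF tendsto_inverse_0]]
          tendsto_add_filterlim_at_infinity[OF tendsto_const] tendsto_of_nat)
  also have "(\<lambda>n. 1 / 2 * (inverse (1 + real n) - inverse (1 + real (Suc n)))) =
      (\<lambda>n. 2 / ((2 * real n + 3)\<^sup>2 - 1))"
  proof
    fix n
    have "(2 * real n + 3)\<^sup>2 - 1 = 4 * ((1 + real n) * (1 + real (Suc n)))"
      by (simp add: algebra_simps power2_eq_square)
    moreover have "inverse (1 + real n) - inverse (1 + real (Suc n)) =
        1 / ((1 + real n) * (1 + real (Suc n)))"
      by (simp add: divide_simps)
    ultimately show "1 / 2 * (inverse (1 + real n) - inverse (1 + real (Suc n))) =
      2 / ((2 * real n + 3)\<^sup>2 - 1)"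
      by simp
  qed
  finally show ?thesis by simp
qed

lemma odd_square_gap: "(2 * real n + 3)\<^sup>2 - 1 \<ge> 8"
  by (simp add: power2_eq_square algebra_simps)

lemma summable_odd_tail:
  fixes w :: "'a::{real_normed_field,banach}"
  assumes "norm w \<le> 1"
  shows "summable (\<lambda>n. 2 / ((2 * of_nat n + 3)\<^sup>2 - w))"
    and "norm (2 / ((2 * of_nat n + 3)\<^sup>2 - w)) \<le> 2 / ((2 * real n + 3)\<^sup>2 - norm w)"
    and "2 / ((2 * real n + 3)\<^sup>2 - norm w) \<le> 2 / ((2 * real n + 3)\<^sup>2 - 1)"
proof -
  have n: "norm (2 / ((2 * of_nat n + 3)\<^sup>2 - w)) \<le> 2 / ((2 * real n + 3)\<^sup>2 - norm w)" for n
  proof -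
    have "norm ((2 * of_nat n + 3)\<^sup>2 :: 'a) = (2 * real n + 3)\<^sup>2"
      using norm_of_nat[of "(2 * n + 3)\<^sup>2", where ?'a = 'a] by simp
    then have "(2 * real n + 3)\<^sup>2 - norm w \<le> norm ((2 * of_nat n + 3)\<^sup>2 - w)"
      using norm_triangle_ineq2[of "(2 * of_nat n + 3)\<^sup>2" w] by simp
    moreover have "(2 * real n + 3)\<^sup>2 - norm w > 0"
      using odd_square_gap[of n] assms by linarith
    ultimately show ?thesis
      by (simp add: norm_divide frac_le)
  qed
  have m: "2 / ((2 * real n + 3)\<^sup>2 - norm w) \<le> 2 / ((2 * real n + 3)\<^sup>2 - 1)" for n
    using odd_square_gap[of n] assms by (intro frac_le) auto
  show "summable (\<lambda>n. 2 / ((2 * of_nat n + 3)\<^sup>2 - w))"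
    by (rule summable_comparison_test'[OF sums_summable[OF odd_tail_sums_one], of 0])
       (use order_trans[OF n m] in auto)
  show "norm (2 / ((2 * of_nat n + 3)\<^sup>2 - w)) \<le> 2 / ((2 * real n + 3)\<^sup>2 - norm w)"
    by (rule n)
  show "2 / ((2 * real n + 3)\<^sup>2 - norm w) \<le> 2 / ((2 * real n + 3)\<^sup>2 - 1)"
    by (rule m)
qed

lemma norm_odd_tail_le:
  fixes w :: "'a::{real_normed_field,banach}"
  assumes "norm w \<le> 1"
  shows "norm (odd_tail w) \<le> odd_tail (norm w)"
  unfolding odd_tail_def
  using summable_odd_tail(1)[of "norm w"] summable_odd_tail(2)[OF assms] assms
  by (intro norm_suminf_le) auto

lemma odd_tail_of_real:
  assumes "\<bar>s\<bar> \<le> 1"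
  shows "odd_tail (of_real s :: complex) = of_real (odd_tail s)"
  unfolding odd_tail_def
  using suminf_of_real[OF summable_odd_tail(1)[of s], where ?'a = complex] assms by simp

lemma odd_tail_one: "odd_tail (1::real) = 1 / 2"
  using odd_tail_sums_one by (simp add: odd_tail_def sums_iff)

text \<open>Termwise, the difference quotient is \<open>2 / ((k\<^sup>2 - t) (k\<^sup>2 - s))\<close>, and \<open>k\<^sup>2 - s \<ge> 8\<close> for odd \<open>k \<ge> 3\<close>
  costs a factor \<open>1/8\<close> against the terms of the series with sum \<open>1/2\<close>. Together with the boundary
  value \<open>1/2\<close> this pins the tail to within \<open>1/16\<close> on the whole interval.\<close>

lemma odd_tail_increment:
  fixes s t :: real
  assumes "0 \<le> s" "s \<le> t" "t \<le> 1"
  shows "odd_tail s \<le> odd_tail t" "odd_tail t \<le> odd_tail s + (t - s) / 16"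
proof -
  have S: "summable (\<lambda>n. 2 / ((2 * real n + 3)\<^sup>2 - s))" "summable (\<lambda>n. 2 / ((2 * real n + 3)\<^sup>2 - t))"
    using summable_odd_tail(1)[of s] summable_odd_tail(1)[of t] assms by auto
  have le: "2 / ((2 * real n + 3)\<^sup>2 - s) \<le> 2 / ((2 * real n + 3)\<^sup>2 - t)" for n
    using odd_square_gap[of n] assms by (intro frac_le) auto
  show "odd_tail s \<le> odd_tail t"
    unfolding odd_tail_def by (intro suminf_le le) (use S in auto)
  have diff: "2 / ((2 * real n + 3)\<^sup>2 - t) - 2 / ((2 * real n + 3)\<^sup>2 - s)
      \<le> (t - s) / 8 * (2 / ((2 * real n + 3)\<^sup>2 - 1))" for n
  proof -
    define k where "k = (2 * real n + 3)\<^sup>2"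
    have k: "k \<ge> 9" using odd_square_gap[of n] by (simp add: k_def)
    have "2 / (k - t) - 2 / (k - s) = (t - s) / (k - s) * (2 / (k - t))"
      using k assms by (simp add: field_simps)
    also have "\<dots> \<le> (t - s) / 8 * (2 / (k - 1))"
      using k assms by (intro mult_mono frac_le) auto
    finally show ?thesis by (simp add: k_def)
  qed
  have "odd_tail t - odd_tail s = (\<Sum>n. 2 / ((2 * real n + 3)\<^sup>2 - t) - 2 / ((2 * real n + 3)\<^sup>2 - s))"
    unfolding odd_tail_def using suminf_diff[OF S(2) S(1)] by simp
  also have "\<dots> \<le> (\<Sum>n. (t - s) / 8 * (2 / ((2 * real n + 3)\<^sup>2 - 1)))"
    by (intro suminf_le diff summable_diff S summable_mult sums_summable[OF odd_tail_sums_one])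
  also have "\<dots> = (t - s) / 8 * (1 / 2)"
    using sums_mult[OF odd_tail_sums_one, of "(t - s) / 8"] by (simp add: sums_iff)
  finally show "odd_tail t \<le> odd_tail s + (t - s) / 16" by linarith
qed

lemma odd_tail_bounds:
  fixes s :: real
  assumes "0 \<le> s" "s \<le> 1"
  shows "0 \<le> odd_tail s" "odd_tail s \<le> 1 / 2" "1 / 2 - (1 - s) / 16 \<le> odd_tail s"
proof -
  show "odd_tail s \<le> 1 / 2" "1 / 2 - (1 - s) / 16 \<le> odd_tail s"
    using odd_tail_increment[of s 1] assms odd_tail_one by linarith+
  with assms show "0 \<le> odd_tail s" by (simp add: field_simps)
qed

section \<open>Monotonicity and positivity of the Nehari function\<close>

text \<open>The function \<open>p\<close> in the variable \<open>s = x\<^sup>2\<close>, with the tangent replaced by its expansion. In this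
  form all coefficients are nonnegative for admissible parameters: the negative mixed term of \<open>p\<close>
  has been absorbed by the square of the tangent.\<close>

definition nehari_expansion :: "real \<Rightarrow> real \<Rightarrow> 'a::{real_normed_field,banach} \<Rightarrow> 'a" where
  "nehari_expansion lam mu s =
     of_real (4 * (lam + mu) * (1 - (lam + mu))) * s / (1 - s)\<^sup>2
     + of_real (4 * mu * (1 - (lam + mu))) * s * odd_tail s / (1 - s)
     + of_real (mu * (1 - mu)) * s * (odd_tail s)\<^sup>2
     + of_real (2 * lam) / (1 - s) + of_real (mu * pi\<^sup>2 / 4)"

text \<open>Only \<open>\<pi> tan (\<pi>z/2) = 4 z d + 2 z h\<close> is used, where \<open>d = 1 / (1 - z\<^sup>2)\<close> and \<open>h\<close> is the tail;
  what remains is an identity between polynomials in \<open>z\<close>, \<open>d\<close> and \<open>h\<close>.\<close>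

lemma nehari_p_expansion_complex:
  fixes z :: complex
  assumes z: "z \<in> unit_disc"
  shows "nehari_p lam mu z = nehari_expansion lam mu (z\<^sup>2)"
proof -
  define L M d h T :: complex where "L = of_real lam" "M = of_real mu" "d = 1 / (1 - z\<^sup>2)"
    "h = odd_tail (z\<^sup>2)" "T = tan (of_real pi * z / 2)"
  note defs = this
  have T: "of_real pi * T = 4 * z * d + 2 * z * h"
    using half_pi_tan_expansion[OF z] by (simp add: defs field_simps)
  have "nehari_p lam mu z = 4 * L * (1 - L) * z\<^sup>2 * d\<^sup>2 + 2 * L * d + M * (of_real pi)\<^sup>2 / 4
      + M * (1 - M) / 4 * (of_real pi * T)\<^sup>2 - 2 * M * L * z * d * (of_real pi * T)"
    by (simp add: nehari_p_def defs power_mult_distrib power_divide ac_simps)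
  also have "\<dots> = 4 * (L + M) * (1 - (L + M)) * z\<^sup>2 * d\<^sup>2 + 4 * M * (1 - (L + M)) * z\<^sup>2 * h * d
      + M * (1 - M) * z\<^sup>2 * h\<^sup>2 + 2 * L * d + M * (of_real pi)\<^sup>2 / 4"
    unfolding T by (simp add: field_simps power2_eq_square)
  also have "\<dots> = nehari_expansion lam mu (z\<^sup>2)"
    by (simp add: nehari_expansion_def defs power_divide)
  finally show ?thesis .
qed

lemma nehari_p_of_real:
  "nehari_p lam mu (of_real x :: complex) = of_real (nehari_p lam mu x)"
proof -
  have "tan (of_real pi * of_real x / 2 :: complex) = of_real (tan (pi * x / 2))"
    using tan_of_real[of "pi * x / 2", where ?'a = complex] by simp
  then show ?thesis by (simp add: nehari_p_def)
qed

lemma nehari_p_expansion_real: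
  fixes x :: real
  assumes x: "\<bar>x\<bar> < 1"
  shows "nehari_p lam mu x = nehari_expansion lam mu (x\<^sup>2)"
proof -
  have "\<bar>x\<^sup>2\<bar> \<le> 1"
    using x by (simp add: abs_square_le_1)
  then have "odd_tail ((of_real x)\<^sup>2) = (of_real (odd_tail (x\<^sup>2)) :: complex)"
    using odd_tail_of_real[of "x\<^sup>2"] by simp
  then have "nehari_expansion lam mu ((of_real x)\<^sup>2) = (of_real (nehari_expansion lam mu (x\<^sup>2)) :: complex)"
    by (simp add: nehari_expansion_def)
  then have "of_real (nehari_p lam mu x) = (of_real (nehari_expansion lam mu (x\<^sup>2)) :: complex)"
    using nehari_p_expansion_complex[of "of_real x" lam mu] x by (simp add: nehari_p_of_real)
  then show ?thesis by simp
qed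

text \<open>In the expansion every term has a nonnegative coefficient and every factor is bounded by its value
  at the modulus, since \<open>|1 - s| \<ge> 1 - |s|\<close> and the tail has the same property. This is what makes
  the extremal function satisfy the criterion in the whole disc and not only on the real axis.\<close>

lemma norm_nehari_p_le:
  fixes z :: complex
  assumes z: "z \<in> unit_disc" and "lam \<ge> 0" "mu \<ge> 0" "lam + mu \<le> 1"
  shows "cmod (nehari_p lam mu z) \<le> nehari_p lam mu (cmod z)"
proof -
  define s where "s = z\<^sup>2"
  have s: "cmod s < 1"
    using z by (simp add: s_def norm_power power_less_one_iff)
  have n: "1 - cmod s \<le> cmod (1 - s)"
    using norm_triangle_ineq2[of 1 s] by simp
  have h: "cmod (odd_tail s) \<le> odd_tail (cmod s)"
    using norm_odd_tail_le[of s] s by simp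
  have coef: "lam \<le> 1" "mu \<le> 1" using assms by auto
  define c1 c2 c3 c4 c5 where "c1 = 4 * (lam + mu) * (1 - (lam + mu))"
    "c2 = 4 * mu * (1 - (lam + mu))" "c3 = mu * (1 - mu)" "c4 = 2 * lam" "c5 = mu * pi\<^sup>2 / 4"
  note defs = this
  have c: "c1 \<ge> 0" "c2 \<ge> 0" "c3 \<ge> 0" "c4 \<ge> 0" "c5 \<ge> 0"
    using assms coef by (auto simp: defs)
  have "cmod (nehari_expansion lam mu s) \<le>
      cmod (of_real c1 * s / (1 - s)\<^sup>2) + cmod (of_real c2 * s * odd_tail s / (1 - s))
     + cmod (of_real c3 * s * (odd_tail s)\<^sup>2) + cmod (of_real c4 / (1 - s)) + cmod (of_real c5 :: complex)"
    unfolding nehari_expansion_def defs[symmetric] by (intro norm_triangle_le add_mono order_refl)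
  also have "\<dots> = c1 * cmod s / (cmod (1 - s))\<^sup>2 + c2 * cmod s * cmod (odd_tail s) / cmod (1 - s)
     + c3 * cmod s * (cmod (odd_tail s))\<^sup>2 + c4 / cmod (1 - s) + c5"
    using c by (simp add: norm_mult norm_divide norm_power)
  also have "\<dots> \<le> c1 * cmod s / (1 - cmod s)\<^sup>2 + c2 * cmod s * odd_tail (cmod s) / (1 - cmod s)
     + c3 * cmod s * (odd_tail (cmod s))\<^sup>2 + c4 / (1 - cmod s) + c5"
    using c s n h odd_tail_bounds(1)[of "cmod s"]
    by (intro add_mono frac_le mult_left_mono mult_nonneg_nonneg power_mono order_refl) auto
  also have "\<dots> = nehari_expansion lam mu (cmod s)"
    by (simp add: nehari_expansion_def defs)
  finally show ?thesis
    using nehari_p_expansion_complex[OF z, of lam mu] nehari_p_expansion_real[of "cmod z" lam mu] z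
    by (simp add: s_def norm_power)
qed

text \<open>Write \<open>\<lambda> = (1 - \<mu>)/2 + e\<close>. On the edge \<open>e = 0\<close> of the parameter region the weighted function
  contains the tail only in \<open>s (1 + (1 - s) h)\<^sup>2\<close>, whose growth is outweighed by the decrease of
  \<open>(\<pi>\<^sup>2/4) (1 - s)\<^sup>2\<close>; moving into the region adds a term with the factor \<open>e \<ge> 0\<close> that decreases
  by itself.\<close>

lemma nehari_expansion_decomposition:
  fixes s lam mu :: real
  assumes "s < 1"
  defines "e \<equiv> lam - (1 - mu) / 2"
  shows "(1 - s)\<^sup>2 * nehari_expansion lam mu s =
      (1 - mu) + mu * (1 - mu) * (s * (1 + (1 - s) * odd_tail s)\<^sup>2) + mu * (pi\<^sup>2 / 4) * (1 - s)\<^sup>2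
      + e * (2 - (2 + 4 * e + 4 * mu) * s - 4 * mu * (s * (1 - s) * odd_tail s))"
proof -
  define r where "r = 1 - s"
  have r: "r \<noteq> 0" "s = 1 - r" using assms(1) by (auto simp: r_def)
  have lam: "lam = e + (1 - mu) / 2" by (simp add: e_def)
  have "r\<^sup>2 * nehari_expansion lam mu s =
      4 * (lam + mu) * (1 - (lam + mu)) * s + 4 * mu * (1 - (lam + mu)) * s * odd_tail s * r
     + mu * (1 - mu) * s * (odd_tail s)\<^sup>2 * r\<^sup>2 + 2 * lam * r + mu * pi\<^sup>2 / 4 * r\<^sup>2"
    unfolding nehari_expansion_def r_def[symmetric] using r(1)
    by (simp add: field_simps power2_eq_square)
  then show ?thesis
    unfolding r_def[symmetric] lam unfolding r(2)
    by (simp add: power2_eq_square field_simps)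
qed

text \<open>Difference quotients of the two nontrivial groups of the decomposition, with \<open>h\<close> and \<open>k\<close> the values
  of the tail at \<open>s\<close> and \<open>t\<close>. In the second estimate the right-hand side is of second order at \<open>1\<close>;
  the left-hand function has slope \<open>0\<close> there because the boundary value of the tail is exactly \<open>1/2\<close>,
  and this is why \<open>h\<close> is also bounded below in terms of the distance to \<open>1\<close>. The constant \<open>2\<close> stands for \<open>\<pi>\<^sup>2/4\<close>, which is larger.\<close>

lemma nehari_expansion_antimono_aux:
  fixes s t h k :: real
  assumes "0 \<le> s" "s \<le> t" "t \<le> 1" "h \<le> k" "k \<le> h + (t - s) / 16" "0 \<le> h" "k \<le> 1/2"
    "1/2 - (1 - s) / 16 \<le> h"
  shows "s * (1 - s) * h - t * (1 - t) * k \<le> (t - s) / 2"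
    and "t * (1 + (1 - t) * k)\<^sup>2 - s * (1 + (1 - s) * h)\<^sup>2 \<le> 2 * ((1 - s)\<^sup>2 - (1 - t)\<^sup>2)"
proof -
  have "t * (1 - t) * k \<ge> t * (1 - t) * h"
    using assms by (intro mult_left_mono) auto
  then have "s * (1 - s) * h - t * (1 - t) * k \<le> (t - s) * ((s + t - 1) * h)"
    by (simp add: algebra_simps)
  also have "\<dots> \<le> (t - s) * (1 * (1 / 2))"
    using assms by (intro mult_left_mono mult_mono) auto
  finally show "s * (1 - s) * h - t * (1 - t) * k \<le> (t - s) / 2" by simp
next
  define D where "D = t - s"
  define B where "B = 1 + (1 - s) * h"
  define C where "C = 1 + (1 - t) * k"
  have D: "D \<ge> 0" using assms by (simp add: D_def)
  have B1: "B \<ge> 1" unfolding B_def using assms by (simp add: mult_nonneg_nonneg)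
  have C1: "C \<ge> 1" unfolding C_def using assms by (simp add: mult_nonneg_nonneg)
  have "(1 - t) * k \<le> (1 - t) * (1 / 2)"
    using assms by (intro mult_left_mono) auto
  then have C2: "C \<le> 1 + (1 - t) / 2" by (simp add: C_def)
  define m where "m = 1/2 - (2 - s - t) / 16"
  have m0: "m \<ge> 0" using assms by (simp add: m_def)
  have "C - B \<le> - D * m"
  proof -
    have "(1 - t) * k \<le> (1 - t) * (h + D / 16)"
      using assms by (intro mult_left_mono) (auto simp: D_def)
    then have "C - B \<le> - D * (h - (1 - t) / 16)"
      by (simp add: B_def C_def D_def field_simps)
    also have "\<dots> \<le> - D * m"
    proof -
      have "D * m \<le> D * (h - (1 - t) / 16)"
        using D assms by (intro mult_left_mono) (auto simp: m_def field_simps)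
      then show ?thesis by simp
    qed
    finally show ?thesis .
  qed
  then have "(C - B) * (C + B) \<le> (- D * m) * (C + B)"
    using B1 C1 by (intro mult_right_mono) auto
  also have "\<dots> \<le> (- D * m) * 2"
    using B1 C1 D m0 by (intro mult_left_mono_neg) auto
  finally have CB: "s * ((C - B) * (C + B)) \<le> s * (- D * m * 2)"
    using assms by (intro mult_left_mono) auto
  have CC: "D * C\<^sup>2 \<le> D * (1 + (1 - t) / 2)\<^sup>2"
    using C1 C2 D by (intro mult_left_mono power_mono) auto
  have "t * C\<^sup>2 - s * B\<^sup>2 = D * C\<^sup>2 + s * ((C - B) * (C + B))"
    by (simp add: D_def algebra_simps power2_eq_square)
  also have "\<dots> \<le> D * ((1 + (1 - t) / 2)\<^sup>2 - 2 * s * m)"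
    using CB CC by (simp add: algebra_simps)
  also have "\<dots> \<le> D * (2 * (2 - s - t))"
  proof (intro mult_left_mono D)
    define a b where "a = 1 - s" "b = 1 - t"
    have ab: "0 \<le> b" "b \<le> a" "a \<le> 1" "s = 1 - a" "t = 1 - b"
      using assms by (auto simp: a_b_def)
    have "b * b \<le> b" "0 \<le> a * a" "0 \<le> a * b"
      using ab mult_left_mono[of b 1 b] by auto
    with ab have "b * (b * 16) \<le> a * (a * 8) + (a * (b * 8) + (a * 56 + b * 56))"
      by linarith
    then show "(1 + (1 - t) / 2)\<^sup>2 - 2 * s * m \<le> 2 * (2 - s - t)"
      unfolding m_def ab(4,5) using ab(1-3) by (simp add: power2_eq_square field_simps)
  qed
  also have "\<dots> = 2 * ((1 - s)\<^sup>2 - (1 - t)\<^sup>2)"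
    by (simp add: D_def power2_eq_square algebra_simps)
  finally show "t * (1 + (1 - t) * k)\<^sup>2 - s * (1 + (1 - s) * h)\<^sup>2 \<le> 2 * ((1 - s)\<^sup>2 - (1 - t)\<^sup>2)"
    by (simp add: B_def C_def)
qed

text \<open>The hypothesis of Nehari's theorem: \<open>(1 - x\<^sup>2)\<^sup>2 p(x)\<close> does not increase. This is the step at which
  \<open>\<lambda> \<ge> (1 - \<mu>)/2\<close> enters.\<close>

lemma nehari_p_weighted_antimono:
  fixes x y :: real
  assumes "0 \<le> x" "x \<le> y" "y < 1" and "mu \<ge> 0" and "lam + mu \<le> 1" and "(1 - mu) / 2 \<le> lam"
  shows "(1 - y\<^sup>2)\<^sup>2 * nehari_p lam mu y \<le> (1 - x\<^sup>2)\<^sup>2 * nehari_p lam mu x"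
proof -
  define s t where "s = x\<^sup>2" "t = y\<^sup>2"
  have st: "0 \<le> s" "s \<le> t" "t < 1"
    using assms by (auto simp: s_t_def power_mono power_less_one_iff)
  define e where "e = lam - (1 - mu) / 2"
  have e: "e \<ge> 0" "mu \<le> 1" using assms by (auto simp: e_def)
  note h = odd_tail_increment[of s t] odd_tail_bounds[of s] odd_tail_bounds[of t]
  have aux: "s * (1 - s) * odd_tail s - t * (1 - t) * odd_tail t \<le> (t - s) / 2"
    "t * (1 + (1 - t) * odd_tail t)\<^sup>2 - s * (1 + (1 - s) * odd_tail s)\<^sup>2 \<le> 2 * ((1 - s)\<^sup>2 - (1 - t)\<^sup>2)"
    using h st by (intro nehari_expansion_antimono_aux; simp)+
  have sq: "(1 - t)\<^sup>2 \<le> (1 - s)\<^sup>2" using st by (intro power_mono) auto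
  have pi2: "2 \<le> pi\<^sup>2 / 4"
    using power_mono[of 3 pi 2] pi_gt3 by simp
  define A where "A = t * (1 + (1 - t) * odd_tail t)\<^sup>2 - s * (1 + (1 - s) * odd_tail s)\<^sup>2"
  define Q where "Q = (1 - s)\<^sup>2 - (1 - t)\<^sup>2"
  have "(1 - mu) * A \<le> (1 - mu) * (2 * Q)"
    using aux(2) e by (intro mult_left_mono) (auto simp: A_def Q_def)
  also have "\<dots> \<le> 1 * (pi\<^sup>2 / 4 * Q)"
    using e sq assms pi2 by (intro mult_mono mult_right_mono) (auto simp: Q_def)
  finally have first: "mu * ((1 - mu) * A) \<le> mu * (pi\<^sup>2 / 4 * Q)"
    using assms by (intro mult_left_mono) auto
  define R where "R = s * (1 - s) * odd_tail s - t * (1 - t) * odd_tail t"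
  have "mu * R \<le> mu * ((t - s) / 2)"
    using aux(1) assms by (intro mult_left_mono) (auto simp: R_def)
  then have "4 * mu * R - (2 + 4 * e + 4 * mu) * (t - s) \<le> - (2 + 4 * e + 2 * mu) * (t - s)"
    by (simp add: algebra_simps)
  also have "\<dots> \<le> 0"
    using e assms st by (intro mult_nonpos_nonneg) auto
  finally have second: "e * (4 * mu * R - (2 + 4 * e + 4 * mu) * (t - s)) \<le> 0"
    using e by (intro mult_nonneg_nonpos) auto
  have "(1 - t)\<^sup>2 * nehari_expansion lam mu t \<le> (1 - s)\<^sup>2 * nehari_expansion lam mu s"
    using first second unfolding nehari_expansion_decomposition[OF \<open>t < 1\<close>]
      nehari_expansion_decomposition[OF le_less_trans[OF \<open>s \<le> t\<close> \<open>t < 1\<close>]] e_def[symmetric]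
    by (simp add: A_def Q_def R_def algebra_simps)
  then show ?thesis
    using nehari_p_expansion_real[of x lam mu] nehari_p_expansion_real[of y lam mu] assms
    by (simp add: s_t_def)
qed

section \<open>The comparison equation and its solution\<close>

text \<open>A positive solution of \<open>y'' + p y = 0\<close> on \<open>(-1, 1)\<close>. Its reciprocal square is the derivative of the
  extremal function.\<close>

definition nehari_weight :: "real \<Rightarrow> real \<Rightarrow> real \<Rightarrow> real" where
  "nehari_weight lam mu x = (1 - x\<^sup>2) powr lam * cos (pi * x / 2) powr mu"

text \<open>Minus the logarithmic derivative of the weight. It is polymorphic because its real version drives
  the comparison arguments and its complex version is half the pre-Schwarzian of the extremal function.\<close>

definition nehari_slope :: "real \<Rightarrow> real \<Rightarrow> 'a::{real_normed_field,banach} \<Rightarrow> 'a" where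
  "nehari_slope lam mu x =
     of_real (2 * lam) * x / (1 - x\<^sup>2) + of_real (mu * pi / 2) * tan (of_real pi * x / 2)"

text \<open>The Riccati form of \<open>y'' + p y = 0\<close>, with \<open>y' = - U y\<close>. It explains the shape of \<open>p\<close>.\<close>

lemma nehari_slope_derivative:
  fixes x :: "'a::{real_normed_field,banach}"
  assumes x: "1 - x\<^sup>2 \<noteq> 0" and c: "cos (of_real pi * x / 2) \<noteq> 0"
  shows "(nehari_slope lam mu has_field_derivative nehari_p lam mu x + (nehari_slope lam mu x)\<^sup>2) (at x)"
proof -
  define L M d T P :: 'a where "L = of_real lam" "M = of_real mu" "d = inverse (1 - x\<^sup>2)"
    "T = tan (of_real pi * x / 2)" "P = of_real pi"
  note defs = this
  have sec: "inverse ((cos (of_real pi * x / 2))\<^sup>2) = 1 + T\<^sup>2"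
    using tan_sec[OF c] by (simp add: defs power_inverse)
  have d: "x\<^sup>2 * d = d - 1"
    using x by (simp add: defs field_simps)
  have "((\<lambda>x. of_real (2 * lam) * x / (1 - x\<^sup>2) + of_real (mu * pi / 2) * tan (of_real pi * x / 2))
      has_field_derivative
      (of_real (2 * lam) * (1 - x\<^sup>2) - of_real (2 * lam) * x * (- (2 * x))) / ((1 - x\<^sup>2) * (1 - x\<^sup>2))
      + of_real (mu * pi / 2) * (inverse ((cos (of_real pi * x / 2))\<^sup>2) * (of_real pi / 2))) (at x)"
    by (rule derivative_eq_intros DERIV_chain2[OF DERIV_tan] refl x c | simp)+
  also have "(of_real (2 * lam) * (1 - x\<^sup>2) - of_real (2 * lam) * x * (- (2 * x))) / ((1 - x\<^sup>2) * (1 - x\<^sup>2))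
      = 2 * L * d + 4 * L * x\<^sup>2 * d\<^sup>2"
  proof -
    have "(a * D - a * x * (- (2 * x))) / (D * D) = a * inverse D + 2 * a * x\<^sup>2 * (inverse D)\<^sup>2"
      if "D \<noteq> 0" for a D :: 'a
      using that by (simp add: field_simps power2_eq_square)
    from this[OF x, of "2 * L"] show ?thesis by (simp add: defs)
  qed
  also have "2 * L * d + 4 * L * x\<^sup>2 * d\<^sup>2
      + of_real (mu * pi / 2) * (inverse ((cos (of_real pi * x / 2))\<^sup>2) * (of_real pi / 2))
      = (4 * L * (1 - L) * x\<^sup>2 * d\<^sup>2 + 2 * L * d + M * P\<^sup>2 / 4 + M * (1 - M) * P\<^sup>2 / 4 * T\<^sup>2
          - 2 * M * L * P * x * T * d)
        + (2 * L * x * d + M * P / 2 * T)\<^sup>2"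
    unfolding sec by (simp add: defs(2,5) field_simps power2_eq_square)
  also have "\<dots> = nehari_p lam mu x + (nehari_slope lam mu x)\<^sup>2"
    by (simp add: nehari_p_def nehari_slope_def defs field_simps)
  finally show ?thesis by (simp add: nehari_slope_def[abs_def])
qed

lemma real_disc_nonzero:
  fixes x :: real
  assumes "\<bar>x\<bar> < 1"
  shows "1 - x\<^sup>2 > 0" "cos (pi * x / 2) > 0"
proof -
  show "1 - x\<^sup>2 > 0" using assms by (simp add: abs_square_less_1)
  show "cos (pi * x / 2) > 0"
    using assms mult_strict_left_mono[of "- 1" x pi] mult_strict_left_mono[of x 1 pi]
    by (intro cos_gt_zero_pi) (auto simp: abs_less_iff)
qed

lemma nehari_weight_pos: "\<bar>x\<bar> < 1 \<Longrightarrow> nehari_weight lam mu x > 0"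
  using real_disc_nonzero[of x] by (simp add: nehari_weight_def)

lemma nehari_slope_derivative_real:
  fixes x :: real
  assumes "\<bar>x\<bar> < 1"
  shows "(nehari_slope lam mu has_field_derivative nehari_p lam mu x + (nehari_slope lam mu x)\<^sup>2) (at x)"
  using real_disc_nonzero[OF assms] by (intro nehari_slope_derivative) auto

lemma nehari_weight_derivative:
  fixes x :: real
  assumes "\<bar>x\<bar> < 1"
  shows "(nehari_weight lam mu has_field_derivative - nehari_slope lam mu x * nehari_weight lam mu x) (at x)"
proof -
  note pos = real_disc_nonzero[OF assms]
  have "((\<lambda>x. (1 - x\<^sup>2) powr lam * cos (pi * x / 2) powr mu) has_field_derivative
      (lam * (1 - x\<^sup>2) powr (lam - 1) * (- (2 * x))) * cos (pi * x / 2) powr mu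
      + (mu * cos (pi * x / 2) powr (mu - 1) * (- sin (pi * x / 2) * (pi / 2))) * (1 - x\<^sup>2) powr lam) (at x)"
    by (intro DERIV_mult DERIV_chain2[OF has_real_derivative_powr])
       (use pos in \<open>auto intro!: derivative_eq_intros\<close>)
  also have "(1 - x\<^sup>2) powr (lam - 1) = (1 - x\<^sup>2) powr lam / (1 - x\<^sup>2)"
    using pos by (simp add: powr_diff)
  also have "cos (pi * x / 2) powr (mu - 1) = cos (pi * x / 2) powr mu / cos (pi * x / 2)"
    using pos by (simp add: powr_diff)
  also have "(lam * ((1 - x\<^sup>2) powr lam / (1 - x\<^sup>2)) * (- (2 * x))) * cos (pi * x / 2) powr mu
      + (mu * (cos (pi * x / 2) powr mu / cos (pi * x / 2)) * (- sin (pi * x / 2) * (pi / 2))) * (1 - x\<^sup>2) powr lam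
      = - nehari_slope lam mu x * nehari_weight lam mu x"
    by (simp add: nehari_slope_def nehari_weight_def tan_def algebra_simps)
  finally show ?thesis by (simp add: nehari_weight_def[abs_def])
qed

text \<open>Both \<open>1 - x\<^sup>2\<close> and \<open>cos (\<pi>x/2)\<close> vanish linearly at \<open>1\<close>, so \<open>y\<^sup>2\<close> vanishes to the order
  \<open>2 (\<lambda> + \<mu>) \<ge> 1\<close>. Consequently \<open>1 / y\<^sup>2\<close> has a divergent integral, which is what sharpness needs.\<close>

lemma nehari_weight_square_le:
  fixes x :: real
  assumes "lam \<ge> 0" "mu \<ge> 0" "1 / 2 \<le> lam + mu" "0 \<le> x" "x < 1"
  shows "(nehari_weight lam mu x)\<^sup>2 \<le> (2 powr lam * (pi / 2) powr mu)\<^sup>2 * (1 - x)"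
proof -
  have x: "\<bar>x\<bar> < 1" using assms by simp
  note pos = real_disc_nonzero[OF x]
  have "1 - x\<^sup>2 = (1 + x) * (1 - x)" by (simp add: power2_eq_square algebra_simps)
  also have "\<dots> \<le> 2 * (1 - x)" using assms by (intro mult_right_mono) auto
  finally have 1: "(1 - x\<^sup>2) powr lam \<le> (2 * (1 - x)) powr lam"
    using assms pos by (intro powr_mono2) auto
  have "cos (pi * x / 2) = sin (pi / 2 * (1 - x))"
    by (subst cos_sin_eq) (simp add: right_diff_distrib)
  also have "\<dots> \<le> pi / 2 * (1 - x)"
    using assms by (intro sin_x_le_x) auto
  finally have 2: "cos (pi * x / 2) powr mu \<le> (pi / 2 * (1 - x)) powr mu"
    using assms pos by (intro powr_mono2) auto
  have "nehari_weight lam mu x \<le> (2 * (1 - x)) powr lam * (pi / 2 * (1 - x)) powr mu"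
    unfolding nehari_weight_def using 1 2 by (intro mult_mono) auto
  also have "\<dots> = (2 powr lam * (pi / 2) powr mu) * (1 - x) powr (lam + mu)"
    using powr_mult[of 2 "1 - x" lam] powr_mult[of "pi / 2" "1 - x" mu] assms
    by (simp only: powr_add ac_simps)
  finally have "(nehari_weight lam mu x)\<^sup>2 \<le> ((2 powr lam * (pi / 2) powr mu) * (1 - x) powr (lam + mu))\<^sup>2"
    using nehari_weight_pos[OF x, of lam mu] by (intro power_mono) auto
  also have "\<dots> = (2 powr lam * (pi / 2) powr mu)\<^sup>2 * (1 - x) powr (2 * (lam + mu))"
    by (simp add: power_mult_distrib power2_eq_square flip: powr_add)
  also have "(1 - x) powr (2 * (lam + mu)) \<le> (1 - x) powr 1"
    using assms by (intro powr_mono') auto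
  finally show ?thesis using assms by (simp add: mult_left_mono)
qed

section \<open>Sturm comparison\<close>

text \<open>Sturm comparison for complex solutions, in a form without integrals. The quantity
  \<open>Q = Re (cnj u u') + U |u|\<^sup>2\<close> satisfies \<open>Q' = |u' + U u|\<^sup>2 + (p - Re q) |u|\<^sup>2 \<ge> 0\<close> and vanishes at the
  right end, so \<open>Q \<le> 0\<close>. But \<open>2 Q / y\<^sup>2\<close> is the derivative of \<open>|u|\<^sup>2 / y\<^sup>2\<close>, which is nonnegative and
  starts at \<open>0\<close>; so it stays \<open>0\<close>. The solution lives on a complex neighbourhood and is only
  followed along the real segment.\<close>

lemma comparison_excludes_two_zeros:
  fixes u u1 q :: "complex \<Rightarrow> complex" and p U y :: "real \<Rightarrow> real"
  assumes "a \<le> b"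
    and u: "\<And>t. t \<in> {a..b} \<Longrightarrow> (u has_field_derivative u1 (of_real t)) (at (of_real t))"
    and u1: "\<And>t. t \<in> {a..b} \<Longrightarrow>
        (u1 has_field_derivative - q (of_real t) * u (of_real t)) (at (of_real t))"
    and q: "\<And>t. t \<in> {a..b} \<Longrightarrow> Re (q (of_real t)) \<le> p t"
    and U: "\<And>t. t \<in> {a..b} \<Longrightarrow> (U has_field_derivative p t + (U t)\<^sup>2) (at t)"
    and y: "\<And>t. t \<in> {a..b} \<Longrightarrow> (y has_field_derivative - U t * y t) (at t)"
    and ypos: "\<And>t. t \<in> {a..b} \<Longrightarrow> y t > 0"
    and ends: "u (of_real a) = 0" "u (of_real b) = 0" and t: "t \<in> {a..b}"
  shows "u (of_real t) = 0"
proof -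
  define r i r1 i1 where "r t = Re (u (of_real t))" "i t = Im (u (of_real t))"
    "r1 t = Re (u1 (of_real t))" "i1 t = Im (u1 (of_real t))" for t
  note defs = this
  define Q where "Q t = r t * r1 t + i t * i1 t + U t * ((r t)\<^sup>2 + (i t)\<^sup>2)" for t
  have dr: "(r has_field_derivative r1 t) (at t)" "(i has_field_derivative i1 t) (at t)"
    if "t \<in> {a..b}" for t
    using has_vector_derivative_real_field[OF u[OF that]]
    by (simp_all add: has_vector_derivative_complex_iff defs[abs_def])
  have dr1: "(r1 has_field_derivative Re (- q (of_real t) * u (of_real t))) (at t)"
    "(i1 has_field_derivative Im (- q (of_real t) * u (of_real t))) (at t)"
    if "t \<in> {a..b}" for t
    using has_vector_derivative_real_field[OF u1[OF that]]
    by (simp_all add: has_vector_derivative_complex_iff defs[abs_def])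
  have dQ: "\<exists>D. (Q has_field_derivative D) (at t) \<and> D \<ge> 0" if t: "t \<in> {a..b}" for t
  proof (intro exI conjI)
    show "(Q has_field_derivative (r1 t)\<^sup>2 + r t * Re (- q (of_real t) * u (of_real t))
        + (i1 t)\<^sup>2 + i t * Im (- q (of_real t) * u (of_real t))
        + (p t + (U t)\<^sup>2) * ((r t)\<^sup>2 + (i t)\<^sup>2) + U t * (2 * r t * r1 t + 2 * i t * i1 t)) (at t)"
      unfolding Q_def[abs_def]
      by (rule derivative_eq_intros dr[OF t] dr1[OF t] U[OF t] refl)+
         (simp add: power2_eq_square algebra_simps)
    have "(r1 t)\<^sup>2 + r t * Re (- q (of_real t) * u (of_real t))
        + (i1 t)\<^sup>2 + i t * Im (- q (of_real t) * u (of_real t))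
        + (p t + (U t)\<^sup>2) * ((r t)\<^sup>2 + (i t)\<^sup>2) + U t * (2 * r t * r1 t + 2 * i t * i1 t)
        = (r1 t + U t * r t)\<^sup>2 + (i1 t + U t * i t)\<^sup>2 + (p t - Re (q (of_real t))) * ((r t)\<^sup>2 + (i t)\<^sup>2)"
      by (simp add: defs power2_eq_square algebra_simps)
    also have "\<dots> \<ge> 0"
      using q[OF t] by (intro add_nonneg_nonneg mult_nonneg_nonneg) auto
    finally show "0 \<le> (r1 t)\<^sup>2 + r t * Re (- q (of_real t) * u (of_real t))
        + (i1 t)\<^sup>2 + i t * Im (- q (of_real t) * u (of_real t))
        + (p t + (U t)\<^sup>2) * ((r t)\<^sup>2 + (i t)\<^sup>2) + U t * (2 * r t * r1 t + 2 * i t * i1 t)" .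
  qed
  have "Q s \<le> Q b" if "s \<in> {a..b}" for s
    by (rule DERIV_nonneg_imp_nondecreasing[of s b Q]) (use that dQ in auto)
  moreover have "Q b = 0" using ends by (simp add: Q_def defs)
  ultimately have Q: "Q s \<le> 0" if "s \<in> {a..b}" for s
    using that by force
  define N where "N t = ((r t)\<^sup>2 + (i t)\<^sup>2) / (y t)\<^sup>2" for t
  have "N t \<le> N a"
  proof (rule DERIV_nonpos_imp_nonincreasing[of a t N])
    show "a \<le> t" using t by simp
    fix s assume "a \<le> s" "s \<le> t"
    then have s: "s \<in> {a..b}" using t by auto
    have "(N has_field_derivative
        ((2 * r s * r1 s + 2 * i s * i1 s) * (y s)\<^sup>2 - ((r s)\<^sup>2 + (i s)\<^sup>2) * (2 * y s * (- U s * y s)))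
         / ((y s)\<^sup>2 * (y s)\<^sup>2)) (at s)"
      unfolding N_def[abs_def] using ypos[OF s]
      by (intro DERIV_divide) (auto intro!: derivative_eq_intros dr[OF s] y[OF s])
    also have "((2 * r s * r1 s + 2 * i s * i1 s) * (y s)\<^sup>2 - ((r s)\<^sup>2 + (i s)\<^sup>2) * (2 * y s * (- U s * y s)))
         / ((y s)\<^sup>2 * (y s)\<^sup>2) = 2 * Q s / (y s)\<^sup>2"
      using ypos[OF s] by (simp add: Q_def field_simps power2_eq_square)
    finally show "\<exists>D. (N has_field_derivative D) (at s) \<and> D \<le> 0"
      using Q[OF s] by (auto intro!: exI[of _ "2 * Q s / (y s)\<^sup>2"] simp: divide_nonpos_nonneg)
  qed
  also have "N a = 0" using ends by (simp add: N_def defs)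
  finally have "(r t)\<^sup>2 + (i t)\<^sup>2 \<le> 0"
    using ypos[OF t] by (simp add: N_def divide_le_0_iff)
  then show ?thesis
    by (simp add: defs complex_eq_iff sum_power2_le_zero_iff)
qed

text \<open>The converse comparison. As long as \<open>u\<close> has no zero, \<open>n = y\<^sup>2 (u'/u + U)\<close> satisfies the Riccati
  equation \<open>n' = - (q - p) y\<^sup>2 - n\<^sup>2 / y\<^sup>2\<close>. It starts at \<open>0\<close> and becomes negative because \<open>q > p\<close> at \<open>x0\<close>;
  from then on \<open>(1/n)' \<ge> 1 / y\<^sup>2 \<ge> 1 / (C (1 - t))\<close>, and the logarithmic divergence would make the
  negative function \<open>1/n\<close> reach \<open>0\<close> before the end of the interval.\<close>

lemma comparison_forces_zero:
  fixes u u1 q p U y :: "real \<Rightarrow> real"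
  assumes "x0 < 1"
    and u: "\<And>t. t \<in> {x0..<1} \<Longrightarrow> (u has_field_derivative u1 t) (at t)"
    and u1: "\<And>t. t \<in> {x0..<1} \<Longrightarrow> (u1 has_field_derivative - q t * u t) (at t)"
    and q: "\<And>t. t \<in> {x0..<1} \<Longrightarrow> p t \<le> q t"
    and U: "\<And>t. t \<in> {x0..<1} \<Longrightarrow> (U has_field_derivative p t + (U t)\<^sup>2) (at t)"
    and y: "\<And>t. t \<in> {x0..<1} \<Longrightarrow> (y has_field_derivative - U t * y t) (at t)"
    and ypos: "\<And>t. t \<in> {x0..<1} \<Longrightarrow> y t > 0"
    and C: "C > 0" and yC: "\<And>t. t \<in> {x0..<1} \<Longrightarrow> 0 \<le> t \<Longrightarrow> (y t)\<^sup>2 \<le> C * (1 - t)"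
    and q0: "p x0 < q x0" and u0: "u x0 \<noteq> 0" and slope: "u1 x0 = - U x0 * u x0"
  shows "\<exists>x\<in>{x0<..<1}. u x = 0"
proof (rule ccontr)
  assume "\<not> ?thesis"
  then have nz: "u t \<noteq> 0" if "t \<in> {x0..<1}" for t
    using that u0 by (cases "t = x0") auto
  define n where "n t = (y t)\<^sup>2 * (u1 t / u t + U t)" for t
  define n' where "n' t = - (q t - p t) * (y t)\<^sup>2 - (n t)\<^sup>2 / (y t)\<^sup>2" for t
  have dn: "(n has_field_derivative n' t) (at t)" if t: "t \<in> {x0..<1}" for t
  proof -
    have "(n has_field_derivative (2 * y t * (- U t * y t)) * (u1 t / u t + U t)
        + ((- q t * u t * u t - u1 t * u1 t) / (u t * u t) + (p t + (U t)\<^sup>2)) * (y t)\<^sup>2) (at t)"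
      unfolding n_def[abs_def] using nz[OF t]
      by (intro DERIV_mult DERIV_add DERIV_divide u[OF t] u1[OF t] U[OF t])
         (auto intro!: derivative_eq_intros y[OF t])
    also have "(2 * y t * (- U t * y t)) * (u1 t / u t + U t)
        + ((- q t * u t * u t - u1 t * u1 t) / (u t * u t) + (p t + (U t)\<^sup>2)) * (y t)\<^sup>2 = n' t"
      using nz[OF t] ypos[OF t] by (simp add: n'_def n_def field_simps power2_eq_square)
    finally show ?thesis .
  qed
  have n'_nonpos: "n' t \<le> 0" if "t \<in> {x0..<1}" for t
  proof -
    have "0 \<le> (q t - p t) * (y t)\<^sup>2 + (n t)\<^sup>2 / (y t)\<^sup>2"
      using q[OF that] by (intro add_nonneg_nonneg mult_nonneg_nonneg) auto
    then show ?thesis by (simp add: n'_def algebra_simps)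
  qed
  have "n x0 = 0" using u0 slope by (simp add: n_def)
  moreover from this have "n' x0 < 0"
    using q0 ypos[of x0] \<open>x0 < 1\<close> by (simp add: n'_def mult_neg_pos)
  moreover have "(n has_field_derivative n' x0) (at x0)"
    using dn[of x0] \<open>x0 < 1\<close> by simp
  ultimately obtain d where d: "d > 0" "\<And>h. 0 < h \<Longrightarrow> h < d \<Longrightarrow> n (x0 + h) < 0"
    using DERIV_neg_dec_right[of n "n' x0" x0] by force
  define h where "h = min (d / 2) ((1 - x0) / 2)"
  have h: "0 < h" "h < d" "x0 + h < 1"
    using d(1) \<open>x0 < 1\<close> by (auto simp: h_def min_def field_simps)
  have "n (max 0 (x0 + h)) \<le> n (x0 + h)"
  proof (rule DERIV_nonpos_imp_nonincreasing[of "x0 + h" "max 0 (x0 + h)" n])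
    fix t assume "x0 + h \<le> t" "t \<le> max 0 (x0 + h)"
    then have "t \<in> {x0..<1}" using h by auto
    then show "\<exists>D. (n has_field_derivative D) (at t) \<and> D \<le> 0"
      using dn n'_nonpos by blast
  qed auto
  \<comment> \<open>To the right of \<open>0\<close> as well as of \<open>x0\<close>: the bound by \<open>C (1 - t)\<close> is assumed for \<open>t \<ge> 0\<close> only.\<close>
  define x1 where "x1 = max 0 (x0 + h)"
  have x1: "n x1 < 0" "x0 < x1" "0 \<le> x1" "x1 < 1"
    using d(2)[OF h(1,2)] \<open>n (max 0 (x0 + h)) \<le> n (x0 + h)\<close> h by (auto simp: x1_def)
  have neg: "n t < 0" if "t \<in> {x1..<1}" for t
  proof -
    have "n t \<le> n x1"
    proof (rule DERIV_nonpos_imp_nonincreasing[of x1 t n])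
      fix s assume "x1 \<le> s" "s \<le> t"
      then have "s \<in> {x0..<1}" using x1 that by auto
      then show "\<exists>D. (n has_field_derivative D) (at s) \<and> D \<le> 0"
        using dn n'_nonpos by blast
    qed (use that in auto)
    with x1 show ?thesis by simp
  qed
  define k where "k t = 1 / n t + ln (1 - t) / C" for t
  \<comment> \<open>Chosen so that \<open>ln (1 - t) = ln (1 - x1) + C / n x1\<close>, by which time the lower bound for \<open>1/n\<close> is \<open>0\<close>.\<close>
  define t where "t = 1 - (1 - x1) * exp (C / n x1)"
  have "C / n x1 < 0" using x1 C by (simp add: divide_pos_neg)
  then have "0 < (1 - x1) * exp (C / n x1)" "(1 - x1) * exp (C / n x1) \<le> (1 - x1) * 1"
    using x1 by (auto intro!: mult_left_mono)
  then have t: "x1 \<le> t" "t < 1" by (auto simp: t_def)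
  have "k x1 \<le> k t"
  proof (rule DERIV_nonneg_imp_nondecreasing[of x1 t k, OF t(1)])
    fix s assume "x1 \<le> s" "s \<le> t"
    then have s: "s \<in> {x0..<1}" "s \<in> {x1..<1}" "0 \<le> s" "s < 1" using x1 t by auto
    note ns = neg[OF s(2)]
    have y2: "(y s)\<^sup>2 > 0" using ypos[OF s(1)] by simp
    have "(k has_field_derivative - n' s / (n s)\<^sup>2 - 1 / (C * (1 - s))) (at s)"
      unfolding k_def[abs_def] using ns s C
      by (auto intro!: derivative_eq_intros dn[OF s(1)] simp: field_simps power2_eq_square)
    moreover have "1 / (C * (1 - s)) \<le> 1 / (y s)\<^sup>2"
      using yC[OF s(1,3)] y2 s C by (intro divide_left_mono) auto
    moreover have "1 / (y s)\<^sup>2 \<le> - n' s / (n s)\<^sup>2"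
    proof -
      have "0 \<le> (q s - p s) * (y s)\<^sup>2 / (n s)\<^sup>2" using q[OF s(1)] by simp
      moreover have "- n' s / (n s)\<^sup>2 = (q s - p s) * (y s)\<^sup>2 / (n s)\<^sup>2 + 1 / (y s)\<^sup>2"
        using ns y2 by (simp add: n'_def field_simps)
      ultimately show ?thesis by simp
    qed
    ultimately show "\<exists>D. (k has_field_derivative D) (at s) \<and> D \<ge> 0"
      by (intro exI[of _ "- n' s / (n s)\<^sup>2 - 1 / (C * (1 - s))"]) auto
  qed
  moreover have "ln (1 - t) = ln (1 - x1) + C / n x1"
    using x1 by (simp add: t_def ln_mult)
  then have "k t = 1 / n t + ln (1 - x1) / C + 1 / n x1"
    using C by (simp add: k_def add_divide_distrib)
  ultimately have "1 / n t \<ge> 0" by (simp add: k_def)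
  with neg[of t] t show False by simp
qed

section \<open>The linear equation of the Schwarzian\<close>

text \<open>The solution is \<open>v = (f')\<^bsup>-1/2\<^esup>\<close>. A branch exists because \<open>f'\<close> has a logarithm \<open>g\<close> on the disc, and
  in terms of \<open>g\<close> the Schwarzian is simply \<open>g'' - g'\<^sup>2/2\<close>.\<close>

lemma schwarzian_linear_equation:
  assumes f: "f holomorphic_on unit_disc" and f': "\<And>z. z \<in> unit_disc \<Longrightarrow> deriv f z \<noteq> 0"
  obtains v v1 where
    "\<And>z. z \<in> unit_disc \<Longrightarrow> v z \<noteq> 0 \<and> deriv f z = 1 / (v z)\<^sup>2"
    "\<And>z. z \<in> unit_disc \<Longrightarrow> (v has_field_derivative v1 z) (at z)"
    "\<And>z. z \<in> unit_disc \<Longrightarrow> (v1 has_field_derivative - (schwarzian f z / 2) * v z) (at z)"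
proof -
  have df: "deriv f holomorphic_on unit_disc"
    using f by (intro holomorphic_deriv) auto
  obtain g where g: "g holomorphic_on unit_disc" "\<And>z. z \<in> unit_disc \<Longrightarrow> exp (g z) = deriv f z"
    by (rule holomorphic_logarithm_exists[OF _ _ df, of 0]) (use f' in auto)
  have dg: "(g has_field_derivative deriv g z) (at z)" if "z \<in> unit_disc" for z
    using holomorphic_derivI[OF g(1) _ that] by simp
  have ddg: "(deriv g has_field_derivative deriv (deriv g) z) (at z)" if "z \<in> unit_disc" for z
    using holomorphic_derivI[OF holomorphic_deriv[OF g(1)] _ that] by simp
  have dd: "deriv (deriv f) z = deriv g z * exp (g z)" if z: "z \<in> unit_disc" for z
  proof -
    have "((\<lambda>z. exp (g z)) has_field_derivative exp (g z) * deriv g z) (at z)"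
      by (rule DERIV_chain2[OF DERIV_exp dg[OF z]])
    then have "(deriv f has_field_derivative exp (g z) * deriv g z) (at z)"
      by (rule has_field_derivative_transform_within_open[where S = unit_disc]) (use g z in auto)
    then show ?thesis by (simp add: DERIV_imp_deriv mult.commute)
  qed
  have quot: "deriv (deriv f) z / deriv f z = deriv g z" if "z \<in> unit_disc" for z
    by (simp add: dd[OF that] g(2)[OF that, symmetric])
  have S: "schwarzian f z = deriv (deriv g) z - (deriv g z)\<^sup>2 / 2" if z: "z \<in> unit_disc" for z
  proof -
    have "((\<lambda>w. deriv (deriv f) w / deriv f w) has_field_derivative deriv (deriv g) z) (at z)"
      by (rule has_field_derivative_transform_within_open[OF ddg[OF z], where S = unit_disc])
         (use quot z in auto)
    then show ?thesis
      using quot[OF z] by (simp add: schwarzian_def DERIV_imp_deriv)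
  qed
  define v where "v z = exp (- g z / 2)" for z
  define v1 where "v1 z = - deriv g z / 2 * v z" for z
  have dv: "(v has_field_derivative v1 z) (at z)" if z: "z \<in> unit_disc" for z
    unfolding v_def[abs_def] v1_def
    by (rule derivative_eq_intros dg[OF z] refl | simp)+
  have dv1: "(v1 has_field_derivative - (schwarzian f z / 2) * v z) (at z)" if z: "z \<in> unit_disc" for z
    unfolding v1_def[abs_def] S[OF z]
    by (rule derivative_eq_intros dv[OF z] ddg[OF z] refl | simp)+
       (simp add: v1_def field_simps power2_eq_square)
  have "(v z)\<^sup>2 = exp (- g z)" for z
    by (simp add: v_def power2_eq_square flip: exp_add)
  then have "v z \<noteq> 0 \<and> deriv f z = 1 / (v z)\<^sup>2" if "z \<in> unit_disc" for z
    using g(2)[OF that] by (simp add: v_def exp_minus field_simps)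
  with dv dv1 show ?thesis using that by blast
qed

text \<open>The functions \<open>v\<close> and \<open>f v\<close> span the solutions, so equal values of \<open>f\<close> are common zeros of one
  solution: \<open>A + B f\<close> and \<open>(A + B f) v\<close> vanish at the same points.\<close>

lemma schwarzian_solutions:
  assumes f: "f holomorphic_on unit_disc"
    and v: "v z \<noteq> 0" "deriv f z = 1 / (v z)\<^sup>2"
      "(v has_field_derivative v1 z) (at z)" "(v1 has_field_derivative - s * v z) (at z)"
    and z: "z \<in> unit_disc"
  shows "((\<lambda>z. (A + B * f z) * v z) has_field_derivative B / v z + (A + B * f z) * v1 z) (at z)"
    and "((\<lambda>z. B / v z + (A + B * f z) * v1 z) has_field_derivative
        - s * ((A + B * f z) * v z)) (at z)"
proof -
  have df: "(f has_field_derivative 1 / (v z)\<^sup>2) (at z)"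
    using holomorphic_derivI[OF f _ z] v(2) by simp
  show "((\<lambda>z. (A + B * f z) * v z) has_field_derivative B / v z + (A + B * f z) * v1 z) (at z)"
    by (rule derivative_eq_intros df v(3) refl)+
       (use v(1) in \<open>simp add: field_simps power2_eq_square\<close>)
  show "((\<lambda>z. B / v z + (A + B * f z) * v1 z) has_field_derivative
        - s * ((A + B * f z) * v z)) (at z)"
    by (rule derivative_eq_intros df v refl)+
       (use v(1) in \<open>simp add: field_simps power2_eq_square\<close>)
qed

section \<open>Hyperbolic lines\<close>

text \<open>The geodesic of the disc whose point closest to the origin is \<open>e i \<rho>\<close>, for \<open>|e| = 1\<close>, parametrised
  by \<open>(-1, 1)\<close> so that this point has parameter \<open>0\<close>.\<close>

definition hyperbolic_line :: "complex \<Rightarrow> real \<Rightarrow> complex \<Rightarrow> complex" where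
  "hyperbolic_line e rho t = e * (t + \<i> * of_real rho) / (1 - \<i> * of_real rho * t)"

definition hyperbolic_speed :: "complex \<Rightarrow> real \<Rightarrow> complex \<Rightarrow> complex" where
  "hyperbolic_speed e rho t = e * (1 - (of_real rho)\<^sup>2) / (1 - \<i> * of_real rho * t)\<^sup>2"

lemma hyperbolic_line_denominator: "1 - \<i> * of_real rho * of_real t \<noteq> (0::complex)"
proof
  assume "1 - \<i> * of_real rho * of_real t = (0::complex)"
  then have "Re (1 - \<i> * of_real rho * of_real t) = Re 0" by (rule arg_cong)
  then show False by simp
qed

lemma hyperbolic_line_derivative:
  "(hyperbolic_line e rho has_field_derivative hyperbolic_speed e rho (of_real t)) (at (of_real t))"
proof -
  have "((\<lambda>t. e * (t + \<i> * of_real rho) / (1 - \<i> * of_real rho * t)) has_field_derivative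
      (e * (1 - \<i> * of_real rho * of_real t) - e * (of_real t + \<i> * of_real rho) * (- (\<i> * of_real rho)))
      / ((1 - \<i> * of_real rho * of_real t) * (1 - \<i> * of_real rho * of_real t))) (at (of_real t))"
    using hyperbolic_line_denominator[of rho t]
    by (intro DERIV_divide) (auto intro!: derivative_eq_intros)
  also have "e * (1 - \<i> * of_real rho * of_real t) - e * (of_real t + \<i> * of_real rho) * (- (\<i> * of_real rho))
      = e * (1 - (of_real rho)\<^sup>2)"
    by (simp add: algebra_simps power2_eq_square)
  finally show ?thesis
    by (simp add: hyperbolic_line_def[abs_def] hyperbolic_speed_def power2_eq_square)
qed

text \<open>The parametrisation comes from a disc automorphism, hence \<open>|G'| (1 - t\<^sup>2) = 1 - |G|\<^sup>2\<close>; and being centred at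
  the closest point to the origin it moves no parameter value closer to \<open>0\<close>. These are the two
  facts that let a radially decreasing bound be pulled back to the real axis.\<close>

lemma hyperbolic_line_bounds:
  assumes e: "cmod e = 1" and rho: "\<bar>rho\<bar> < 1" and t: "\<bar>t\<bar> < 1"
  shows "hyperbolic_line e rho (of_real t) \<in> unit_disc"
    and "\<bar>t\<bar> \<le> cmod (hyperbolic_line e rho (of_real t))"
    and "cmod (hyperbolic_speed e rho (of_real t)) * (1 - t\<^sup>2)
           = 1 - (cmod (hyperbolic_line e rho (of_real t)))\<^sup>2"
    and "hyperbolic_speed e rho (of_real t) \<noteq> 0"
proof -
  define G where "G = hyperbolic_line e rho (of_real t)"
  have r2: "rho\<^sup>2 < 1" and t2: "t\<^sup>2 < 1"
    using rho t by (simp_all add: abs_square_less_1)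
  have den: "(cmod (1 - \<i> * of_real rho * of_real t))\<^sup>2 = 1 + rho\<^sup>2 * t\<^sup>2"
    by (simp add: cmod_power2 power_mult_distrib)
  have pos: "1 + rho\<^sup>2 * t\<^sup>2 > 0" by (intro add_pos_nonneg) auto
  have num: "(cmod (of_real t + \<i> * of_real rho))\<^sup>2 = t\<^sup>2 + rho\<^sup>2"
    by (simp add: cmod_power2)
  have G2: "(cmod G)\<^sup>2 = (t\<^sup>2 + rho\<^sup>2) / (1 + rho\<^sup>2 * t\<^sup>2)"
    by (simp add: G_def hyperbolic_line_def norm_mult norm_divide power_divide e den num)
  have "t\<^sup>2 + rho\<^sup>2 < 1 + rho\<^sup>2 * t\<^sup>2"
    using mult_pos_pos[of "1 - rho\<^sup>2" "1 - t\<^sup>2"] r2 t2 by (simp add: algebra_simps)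
  then have "(cmod G)\<^sup>2 < 1" using pos by (simp add: G2)
  then show "hyperbolic_line e rho (of_real t) \<in> unit_disc"
    by (simp add: G_def[symmetric] abs_square_less_1)
  have "t\<^sup>2 * t\<^sup>2 \<le> 1 * 1"
    using t2 by (intro mult_mono) auto
  then have "rho\<^sup>2 * (t\<^sup>2 * t\<^sup>2) \<le> rho\<^sup>2 * 1" by (intro mult_left_mono) auto
  then have "t\<^sup>2 \<le> (cmod G)\<^sup>2"
    using pos by (simp add: G2 pos_le_divide_eq algebra_simps)
  then have "\<bar>t\<bar> \<le> \<bar>cmod G\<bar>" by (simp only: abs_le_square_iff)
  then show "\<bar>t\<bar> \<le> cmod (hyperbolic_line e rho (of_real t))" by (simp add: G_def)
  have "cmod (1 - (of_real rho)\<^sup>2 :: complex) = 1 - rho\<^sup>2"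
  proof -
    have "(1 - (of_real rho)\<^sup>2 :: complex) = of_real (1 - rho\<^sup>2)" by simp
    then show ?thesis using r2 by (simp only: norm_of_real)
  qed
  then have speed: "cmod (hyperbolic_speed e rho (of_real t)) = (1 - rho\<^sup>2) / (1 + rho\<^sup>2 * t\<^sup>2)"
    by (simp add: hyperbolic_speed_def norm_mult norm_divide norm_power e den)
  then show "cmod (hyperbolic_speed e rho (of_real t)) * (1 - t\<^sup>2)
           = 1 - (cmod (hyperbolic_line e rho (of_real t)))\<^sup>2"
    unfolding G_def[symmetric] speed G2 using pos by (simp add: field_simps)
  have "cmod (hyperbolic_speed e rho (of_real t)) > 0"
    using speed r2 pos by simp
  then show "hyperbolic_speed e rho (of_real t) \<noteq> 0" by simp
qed

text \<open>The image of \<open>z cnj e\<close> under the inverse Moebius map is real exactly when the stated equation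
  holds.\<close>

lemma on_hyperbolic_line:
  assumes e: "cmod e = 1" and rho: "\<bar>rho\<bar> < 1" and z: "z \<in> unit_disc"
    and im: "Im (z * cnj e) * (1 + rho\<^sup>2) = rho * (1 + (cmod z)\<^sup>2)"
  obtains t where "\<bar>t\<bar> < 1" "z = hyperbolic_line e rho (of_real t)"
proof -
  define w where "w = z * cnj e"
  have ew: "e * w = z"
    using complex_norm_square[of e] e by (simp add: w_def mult.left_commute[of e z])
  have w: "cmod w < 1" "cmod w = cmod z"
    using z e by (simp_all add: w_def norm_mult)
  have r2: "rho\<^sup>2 < 1" using rho by (simp add: abs_square_less_1)
  have w2: "(cmod w)\<^sup>2 = (Re w)\<^sup>2 + (Im w)\<^sup>2" "(cmod w)\<^sup>2 < 1"
    using w(1) by (simp_all add: cmod_power2 abs_square_less_1 flip: cmod_power2)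
  define T where "T = (w - \<i> * of_real rho) / (1 + \<i> * of_real rho * w)"
  have nz: "1 + \<i> * of_real rho * w \<noteq> 0"
  proof
    assume "1 + \<i> * of_real rho * w = 0"
    then have "\<i> * of_real rho * w = - 1" by (simp add: eq_neg_iff_add_eq_0 add.commute)
    then have "cmod (\<i> * of_real rho * w) = cmod (- 1)" by (rule arg_cong)
    then have "\<bar>rho\<bar> * cmod w = 1" by (simp add: norm_mult)
    moreover have "\<bar>rho\<bar> * cmod w \<le> \<bar>rho\<bar> * 1" using w by (intro mult_left_mono) auto
    ultimately show False using rho by simp
  qed
  have "Im ((w - \<i> * of_real rho) * cnj (1 + \<i> * of_real rho * w)) =
      Im w * (1 + rho\<^sup>2) - rho * (1 + (cmod w)\<^sup>2)"
    unfolding w2(1) by (simp add: algebra_simps power2_eq_square)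
  also have "\<dots> = 0" using im w by (simp add: w_def[symmetric])
  finally have ImT: "Im T = 0"
    by (simp add: T_def Im_complex_div_eq_0)
  have "(cmod (1 + \<i> * of_real rho * w))\<^sup>2 - (cmod (w - \<i> * of_real rho))\<^sup>2 = (1 - rho\<^sup>2) * (1 - (cmod w)\<^sup>2)"
    unfolding cmod_power2 by (simp add: algebra_simps power2_eq_square)
  moreover have "(1 - rho\<^sup>2) * (1 - (cmod w)\<^sup>2) > 0" using r2 w2(2) by simp
  ultimately have "(cmod (w - \<i> * of_real rho))\<^sup>2 < (cmod (1 + \<i> * of_real rho * w))\<^sup>2" by simp
  then have "cmod (w - \<i> * of_real rho) < cmod (1 + \<i> * of_real rho * w)"
    by (rule power_less_imp_less_base) simp
  then have "cmod T < 1" using nz by (simp add: T_def norm_divide)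
  have T: "T = of_real (Re T)" using ImT by (simp add: complex_eq_iff)
  then have t: "\<bar>Re T\<bar> < 1" using \<open>cmod T < 1\<close> abs_Re_le_cmod[of T] by linarith
  have r1: "1 - (of_real rho)\<^sup>2 \<noteq> (0::complex)"
  proof -
    have "(1 - (of_real rho)\<^sup>2 :: complex) = of_real (1 - rho\<^sup>2)" by simp
    then show ?thesis using r2 by (simp only: of_real_eq_0_iff)
  qed
  have "T + \<i> * of_real rho = w * (1 - (of_real rho)\<^sup>2) / (1 + \<i> * of_real rho * w)"
    using nz by (simp add: T_def field_simps power2_eq_square)
  moreover have "1 - \<i> * of_real rho * T = (1 - (of_real rho)\<^sup>2) / (1 + \<i> * of_real rho * w)"
    using nz by (simp add: T_def field_simps power2_eq_square)
  ultimately have "hyperbolic_line e rho T = e * w"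
    using nz r1 by (simp add: hyperbolic_line_def)
  with ew T t that show ?thesis by metis
qed

text \<open>The map \<open>K z = z / (1 + |z|\<^sup>2)\<close> straightens geodesics (up to a factor \<open>2\<close> it is the passage to the Klein
  model), so \<open>e\<close> is the direction of the chord through the two image points, and \<open>\<rho>\<close> is
  determined by \<open>\<rho> / (1 + \<rho>\<^sup>2) = k\<close>, the distance of the chord from the origin with its sign.\<close>

lemma hyperbolic_line_through_two_points:
  assumes z1: "z1 \<in> unit_disc" and z2: "z2 \<in> unit_disc"
  obtains e rho t1 t2 where "cmod e = 1" "\<bar>rho\<bar> < 1" "\<bar>t1\<bar> < 1" "\<bar>t2\<bar> < 1"
    "z1 = hyperbolic_line e rho (of_real t1)" "z2 = hyperbolic_line e rho (of_real t2)"
proof -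
  define K where "K z = z / of_real (1 + (cmod z)\<^sup>2)" for z
  define e where "e = (if K z1 = K z2 then 1 else sgn (K z1 - K z2))"
  have e: "cmod e = 1" by (simp add: e_def norm_sgn)
  have "Im ((K z1 - K z2) * cnj e) = 0"
    by (auto simp: e_def sgn_eq complex_mult_cnj simp flip: Complex_eq)
  then have same: "Im (K z1 * cnj e) = Im (K z2 * cnj e)"
    by (simp add: left_diff_distrib)
  define k where "k = Im (K z1 * cnj e)"
  have "cmod (K z1) < 1 / 2"
  proof -
    have "(1 - cmod z1)\<^sup>2 > 0" using z1 by simp
    then have "2 * cmod z1 < 1 + (cmod z1)\<^sup>2" by (simp add: power2_eq_square algebra_simps)
    moreover have "cmod (of_real (1 + (cmod z1)\<^sup>2) :: complex) = 1 + (cmod z1)\<^sup>2"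
      by (simp only: norm_of_real) simp
    ultimately show ?thesis
      by (simp add: K_def norm_divide divide_less_eq add_pos_nonneg del: of_real_add)
  qed
  then have "\<bar>k\<bar> < 1 / 2"
    using abs_Im_le_cmod[of "K z1 * cnj e"] e by (simp add: k_def norm_mult)
  then have "\<bar>2 * k\<bar> < 1" by simp
  then have "(2 * k)\<^sup>2 < 1" by (simp only: abs_square_less_1)
  define D where "D = sqrt (1 - (2 * k)\<^sup>2)"
  have D: "D > 0" "D\<^sup>2 = 1 - (2 * k)\<^sup>2"
    using \<open>(2 * k)\<^sup>2 < 1\<close> by (simp_all add: D_def)
  \<comment> \<open>The root of modulus less than \<open>1\<close> of \<open>k \<rho>\<^sup>2 - \<rho> + k = 0\<close>.\<close>
  define rho where "rho = 2 * k / (1 + D)"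
  have rD: "rho\<^sup>2 = (1 - D) / (1 + D)"
  proof -
    have "(2 * k)\<^sup>2 = (1 - D) * (1 + D)" using D(2) by (simp add: power2_eq_square algebra_simps)
    then show ?thesis using D by (simp add: rho_def power_divide power2_eq_square)
  qed
  then have "rho\<^sup>2 < 1" using D by simp
  then have rho: "\<bar>rho\<bar> < 1" by (simp add: abs_square_less_1)
  have rk: "rho = k * (1 + rho\<^sup>2)"
    unfolding rD using D by (simp add: rho_def field_simps)
  have im: "Im (z * cnj e) * (1 + rho\<^sup>2) = rho * (1 + (cmod z)\<^sup>2)" if "Im (K z * cnj e) = k" for z
  proof -
    have pos: "1 + (cmod z)\<^sup>2 > 0" by (intro add_pos_nonneg) auto
    have "K z * cnj e = (z * cnj e) / of_real (1 + (cmod z)\<^sup>2)" by (simp add: K_def)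
    then have "Im (z * cnj e) / (1 + (cmod z)\<^sup>2) = k"
      using that by (simp only: Im_divide_of_real)
    then have "Im (z * cnj e) = k * (1 + (cmod z)\<^sup>2)" using pos by (simp add: field_simps)
    then have "Im (z * cnj e) * (1 + rho\<^sup>2) = (k * (1 + rho\<^sup>2)) * (1 + (cmod z)\<^sup>2)" by simp
    with rk show ?thesis by simp
  qed
  obtain t1 where "\<bar>t1\<bar> < 1" "z1 = hyperbolic_line e rho (of_real t1)"
    using on_hyperbolic_line[OF e rho z1 im] k_def by metis
  moreover obtain t2 where "\<bar>t2\<bar> < 1" "z2 = hyperbolic_line e rho (of_real t2)"
    using on_hyperbolic_line[OF e rho z2 im] k_def same by metis
  ultimately show ?thesis using e rho that by blast
qed

lemma nehari_p_even: "nehari_p lam mu (- x) = nehari_p lam mu x"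
  by (simp add: nehari_p_def)

section \<open>The univalence criterion\<close>

text \<open>If \<open>f\<close> took the value \<open>c\<close> at two points of the line \<open>G\<close>, then \<open>w = (f - c) v\<close> would vanish there.
  The function \<open>u = (w \<circ> G) / sqrt G'\<close>, up to a constant factor, solves \<open>u'' = - (Sf \<circ> G) G'\<^sup>2 u / 2\<close> on
  \<open>(-1, 1)\<close>, and \<open>|Sf (G t)| |G' t|\<^sup>2 / 2 \<le> p(t)\<close> by the monotonicity of \<open>(1 - x\<^sup>2)\<^sup>2 p(x)\<close>. By comparison
  \<open>u\<close> vanishes between the two points, so \<open>f\<close> is constant on an arc, against \<open>f' \<noteq> 0\<close>.\<close>

lemma nehari_criterion_on_line:
  assumes f: "f holomorphic_on unit_disc" and f': "\<And>z. z \<in> unit_disc \<Longrightarrow> deriv f z \<noteq> 0"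
    and bound: "univalence_bound lam mu f"
    and par: "mu \<ge> 0" "lam + mu \<le> 1" "(1 - mu) / 2 \<le> lam"
    and e: "cmod e = 1" and rho: "\<bar>rho\<bar> < 1" and ab: "-1 < a" "a < b" "b < 1"
  shows "f (hyperbolic_line e rho (of_real a)) \<noteq> f (hyperbolic_line e rho (of_real b))"
proof
  let ?G = "hyperbolic_line e rho" and ?S = "hyperbolic_speed e rho"
  define c where "c = f (?G (of_real a))"
  assume "f (?G (of_real a)) = f (?G (of_real b))"
  then have c: "f (?G (of_real a)) = c" "f (?G (of_real b)) = c" by (simp_all add: c_def)
  obtain v v1 where
    v: "\<And>z. z \<in> unit_disc \<Longrightarrow> v z \<noteq> 0 \<and> deriv f z = 1 / (v z)\<^sup>2"
    "\<And>z. z \<in> unit_disc \<Longrightarrow> (v has_field_derivative v1 z) (at z)"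
    "\<And>z. z \<in> unit_disc \<Longrightarrow> (v1 has_field_derivative - (schwarzian f z / 2) * v z) (at z)"
    using schwarzian_linear_equation[OF f f'] by metis
  define w where "w = (\<lambda>z. (- c + 1 * f z) * v z)"
  define w1 where "w1 = (\<lambda>z. 1 / v z + (- c + 1 * f z) * v1 z)"
  have dw: "(w has_field_derivative w1 z) (at z)"
    "(w1 has_field_derivative - (schwarzian f z / 2) * w z) (at z)" if z: "z \<in> unit_disc" for z
    using schwarzian_solutions[OF f _ _ v(2)[OF z] v(3)[OF z] z, where A = "- c" and B = 1] v(1)[OF z]
    by (auto simp: w_def w1_def)
  define u where "u = (\<lambda>t. (1 - \<i> * of_real rho * t) * w (?G t))"
  define u1 where "u1 = (\<lambda>t. - (\<i> * of_real rho) * w (?G t)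
      + e * (1 - (of_real rho)\<^sup>2) / (1 - \<i> * of_real rho * t) * w1 (?G t))"
  define q where "q = (\<lambda>t. schwarzian f (?G t) / 2 * (?S t)\<^sup>2)"
  have disc: "?G (of_real t) \<in> unit_disc" if "t \<in> {a..b}" for t
    using hyperbolic_line_bounds(1)[OF e rho, of t] that ab by auto
  have d_u: "(u has_field_derivative u1 (of_real t)) (at (of_real t))"
    and d_u1: "(u1 has_field_derivative - q (of_real t) * u (of_real t)) (at (of_real t))"
    if t: "t \<in> {a..b}" for t
  proof -
    define d where "d = 1 - \<i> * of_real rho * of_real t"
    have d: "d \<noteq> 0" using hyperbolic_line_denominator by (simp add: d_def)
    note G = disc[OF t]
    note chain = DERIV_chain2[OF dw(1)[OF G] hyperbolic_line_derivative]
      DERIV_chain2[OF dw(2)[OF G] hyperbolic_line_derivative]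
    have S: "?S (of_real t) = e * (1 - (of_real rho)\<^sup>2) / d\<^sup>2"
      by (simp add: hyperbolic_speed_def d_def)
    show "(u has_field_derivative u1 (of_real t)) (at (of_real t))"
      unfolding u_def u1_def d_def[symmetric]
      by (rule derivative_eq_intros chain refl)+
         (use d in \<open>simp add: S flip: d_def, simp add: field_simps power2_eq_square\<close>)
    have "(u1 has_field_derivative - (\<i> * of_real rho) * (w1 (?G (of_real t)) * ?S (of_real t))
       + (e * (1 - (of_real rho)\<^sup>2) * (\<i> * of_real rho) / (d * d) * w1 (?G (of_real t))
       + - (schwarzian f (?G (of_real t)) / 2) * w (?G (of_real t)) * ?S (of_real t)
           * (e * (1 - (of_real rho)\<^sup>2) / d))) (at (of_real t))"
      unfolding u1_def d_def
      by (intro DERIV_add DERIV_mult DERIV_cmult chain)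
         (use d in \<open>auto intro!: derivative_eq_intros simp: d_def\<close>)
    also have "- (\<i> * of_real rho) * (w1 (?G (of_real t)) * ?S (of_real t))
       + (e * (1 - (of_real rho)\<^sup>2) * (\<i> * of_real rho) / (d * d) * w1 (?G (of_real t))
       + - (schwarzian f (?G (of_real t)) / 2) * w (?G (of_real t)) * ?S (of_real t)
           * (e * (1 - (of_real rho)\<^sup>2) / d)) = - q (of_real t) * u (of_real t)"
      unfolding q_def u_def d_def[symmetric] S using d by (simp add: field_simps power2_eq_square)
    finally show "(u1 has_field_derivative - q (of_real t) * u (of_real t)) (at (of_real t))" .
  qed
  have q_le: "Re (q (of_real t)) \<le> nehari_p lam mu t" if "t \<in> {a..b}" for t
  proof -
    have t: "\<bar>t\<bar> < 1" using that ab by auto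
    note B = hyperbolic_line_bounds[OF e rho t]
    define r where "r = cmod (?G (of_real t))"
    have r: "\<bar>t\<bar> \<le> r" "r < 1" using B by (simp_all add: r_def)
    have t2: "1 - t\<^sup>2 > 0" using t by (simp add: abs_square_less_1)
    have "Re (q (of_real t)) * (1 - t\<^sup>2)\<^sup>2 \<le> cmod (q (of_real t)) * (1 - t\<^sup>2)\<^sup>2"
      by (intro mult_right_mono complex_Re_le_cmod) auto
    also have "\<dots> = cmod (schwarzian f (?G (of_real t))) / 2 * (cmod (?S (of_real t)) * (1 - t\<^sup>2))\<^sup>2"
      by (simp add: q_def norm_mult norm_power power_mult_distrib norm_divide)
    also have "\<dots> = cmod (schwarzian f (?G (of_real t))) / 2 * (1 - r\<^sup>2)\<^sup>2"
      unfolding B(3) r_def ..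
    also have "\<dots> \<le> nehari_p lam mu r * (1 - r\<^sup>2)\<^sup>2"
      using bound[unfolded univalence_bound_def, rule_format, OF B(1)]
      by (intro mult_right_mono) (simp_all add: r_def)
    also have "\<dots> \<le> nehari_p lam mu \<bar>t\<bar> * (1 - \<bar>t\<bar>\<^sup>2)\<^sup>2"
      using nehari_p_weighted_antimono[of "\<bar>t\<bar>" r mu lam] r par by (simp add: mult.commute)
    also have "nehari_p lam mu \<bar>t\<bar> = nehari_p lam mu t"
      by (cases "t \<ge> 0") (simp_all add: nehari_p_even)
    finally show ?thesis using t2 by simp
  qed
  have zero: "u (of_real t) = 0" if "t \<in> {a..b}" for t
  proof (rule comparison_excludes_two_zeros[where a = a and b = b and u = u and q = q and p = "nehari_p lam mu"
      and U = "nehari_slope lam mu" and y = "nehari_weight lam mu"])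
    show "u (of_real a) = 0" "u (of_real b) = 0" by (simp_all add: u_def w_def c)
  qed (use ab that d_u d_u1 q_le nehari_slope_derivative_real nehari_weight_derivative
      nehari_weight_pos in auto)
  have const: "f (?G (of_real t)) = c" if "t \<in> {a..b}" for t
    using zero[OF that] v(1)[OF disc[OF that]] hyperbolic_line_denominator[of rho t]
    by (simp add: u_def w_def)
  define m where "m = (a + b) / 2"
  have m: "m \<in> {a<..<b}" using ab by (simp add: m_def)
  then have m': "m \<in> {a..b}" "\<bar>m\<bar> < 1" using ab by auto
  have "((\<lambda>t. f (?G t)) has_field_derivative deriv f (?G (of_real m)) * ?S (of_real m)) (at (of_real m))"
    using DERIV_chain2[OF holomorphic_derivI[OF f _ disc[OF m'(1)]] hyperbolic_line_derivative] by simp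
  then have "((\<lambda>t. f (?G (of_real t))) has_vector_derivative deriv f (?G (of_real m)) * ?S (of_real m)) (at m)"
    by (rule has_vector_derivative_real_field)
  moreover have "((\<lambda>t. f (?G (of_real t))) has_vector_derivative 0) (at m)"
    by (rule has_vector_derivative_transform_within_open[OF has_vector_derivative_const, where S = "{a<..<b}"])
       (use m const in auto)
  ultimately have "deriv f (?G (of_real m)) * ?S (of_real m) = 0"
    by (rule vector_derivative_unique_at)
  then show False
    using f'[OF disc[OF m'(1)]] hyperbolic_line_bounds(4)[OF e rho m'(2)] by simp
qed

lemma nehari_criterion:
  assumes f: "f holomorphic_on unit_disc" and f': "\<And>z. z \<in> unit_disc \<Longrightarrow> deriv f z \<noteq> 0"
    and bound: "univalence_bound lam mu f"
    and par: "mu \<ge> 0" "lam + mu \<le> 1" "(1 - mu) / 2 \<le> lam"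
  shows "inj_on f unit_disc"
proof (rule inj_onI)
  fix z1 z2 assume z: "z1 \<in> unit_disc" "z2 \<in> unit_disc" and eq: "f z1 = f z2"
  obtain e rho t1 t2 where G: "cmod e = 1" "\<bar>rho\<bar> < 1" "\<bar>t1\<bar> < 1" "\<bar>t2\<bar> < 1"
    "z1 = hyperbolic_line e rho (of_real t1)" "z2 = hyperbolic_line e rho (of_real t2)"
    using hyperbolic_line_through_two_points[OF z] by metis
  note line = nehari_criterion_on_line[OF f f' bound par G(1,2)]
  show "z1 = z2"
  proof (cases t1 t2 rule: linorder_cases)
    case less
    then show ?thesis using line[of t1 t2] G eq by (simp add: abs_less_iff)
  next
    case greater
    then show ?thesis using line[of t2 t1] G eq by (simp add: abs_less_iff)
  qed (use G in simp)
qed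

lemma locally_univalent_deriv_nonzero:
  assumes f: "f holomorphic_on S" and loc: "locally_univalent_on f S" and z: "z \<in> S"
  shows "deriv f z \<noteq> 0"
proof -
  obtain U where U: "open U" "z \<in> U" "U \<subseteq> S" "inj_on f U"
    using loc z by (auto simp: locally_univalent_on_def)
  then show ?thesis
    using holomorphic_injective_imp_regular[OF holomorphic_on_subset[OF f U(3)] U(1,4,2)] by simp
qed

section \<open>The extremal function\<close>

lemma complex_disc_nonzero:
  assumes "z \<in> unit_disc"
  shows "1 - z\<^sup>2 \<notin> \<real>\<^sub>\<le>\<^sub>0" "cos (of_real pi * z / 2) \<notin> \<real>\<^sub>\<le>\<^sub>0"
    "1 - z\<^sup>2 \<noteq> 0" "cos (of_real pi * z / 2) \<noteq> 0"
  using Re_one_minus_square_pos[OF assms] Re_cos_half_pi_pos[OF assms]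
  by (auto simp: complex_nonpos_Reals_iff)

lemma extremal_integrand_nonzero:
  assumes "z \<in> unit_disc"
  shows "extremal_integrand lam mu z \<noteq> 0"
  using complex_disc_nonzero[OF assms] by (simp add: extremal_integrand_def)

lemma extremal_integrand_derivative:
  assumes z: "z \<in> unit_disc"
  shows "(extremal_integrand lam mu has_field_derivative
           2 * nehari_slope lam mu z * extremal_integrand lam mu z) (at z)"
proof -
  note nz = complex_disc_nonzero[OF z]
  define A B where "A = 1 - z\<^sup>2" "B = cos (of_real pi * z / 2)"
  note AB = this
  define a b :: complex where "a = of_real (2 * lam)" "b = of_real (2 * mu)"
  note ab = this
  have dA: "((\<lambda>t. (1 - t\<^sup>2) powr a) has_field_derivative a * A powr (a - 1) * (- (2 * z))) (at z)"
    unfolding AB using nz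
    by (intro DERIV_chain2[OF has_field_derivative_powr]) (auto intro!: derivative_eq_intros)
  have dB: "((\<lambda>t. cos (of_real pi * t / 2) powr b) has_field_derivative
      b * B powr (b - 1) * (- sin (of_real pi * z / 2) * (of_real pi / 2))) (at z)"
    unfolding AB using nz
    by (intro DERIV_chain2[OF has_field_derivative_powr]) (auto intro!: derivative_eq_intros)
  have AB0: "A \<noteq> 0" "B \<noteq> 0" using nz by (auto simp: AB)
  then have pw: "A powr (a - 1) = A powr a / A" "B powr (b - 1) = B powr b / B"
    "A powr a \<noteq> 0" "B powr b \<noteq> 0"
    by (auto simp: powr_diff)
  have "((\<lambda>t. 1 / ((1 - t\<^sup>2) powr a * cos (of_real pi * t / 2) powr b)) has_field_derivative
      (0 * (A powr a * B powr b) - 1 * ((a * A powr (a - 1) * (- (2 * z))) * B powr b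
         + (b * B powr (b - 1) * (- sin (of_real pi * z / 2) * (of_real pi / 2))) * A powr a))
       / ((A powr a * B powr b) * (A powr a * B powr b))) (at z)"
    using DERIV_divide[OF DERIV_const[of 1] DERIV_mult[OF dA dB]] pw(3,4) by (simp add: AB)
  also have "(0 * (A powr a * B powr b) - 1 * ((a * A powr (a - 1) * (- (2 * z))) * B powr b
         + (b * B powr (b - 1) * (- sin (of_real pi * z / 2) * (of_real pi / 2))) * A powr a))
       / ((A powr a * B powr b) * (A powr a * B powr b))
      = 2 * (a * z / A + b * (of_real pi / 2) / 2 * (sin (of_real pi * z / 2) / B))
          * (1 / (A powr a * B powr b))"
    unfolding pw(1,2) using AB0 pw(3,4) by (simp add: field_simps)
  also have "\<dots> = 2 * nehari_slope lam mu z * extremal_integrand lam mu z"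
    by (simp add: nehari_slope_def extremal_integrand_def tan_def AB ab)
  finally show ?thesis
    by (simp add: extremal_integrand_def[abs_def] ab)
qed

lemma extremal_fun_derivative:
  assumes z: "z \<in> unit_disc"
  shows "(extremal_fun lam mu has_field_derivative extremal_integrand lam mu z) (at z)"
proof -
  have "extremal_integrand lam mu holomorphic_on unit_disc"
    by (subst holomorphic_on_open) (auto intro: extremal_integrand_derivative)
  then obtain g where g: "\<And>x. x \<in> unit_disc \<Longrightarrow>
      (g has_field_derivative extremal_integrand lam mu x) (at x within unit_disc)"
    using holomorphic_convex_primitive'[of unit_disc] by auto
  have "extremal_fun lam mu w = g w - g 0" if w: "w \<in> unit_disc" for w
  proof -
    have "path_image (linepath 0 w) \<subseteq> unit_disc"
      using w by (simp add: closed_segment_subset)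
    then have "(extremal_integrand lam mu has_contour_integral g w - g 0) (linepath 0 w)"
      using contour_integral_primitive[of unit_disc g _ "linepath 0 w"] g by auto
    then show ?thesis by (simp add: extremal_fun_def contour_integral_unique)
  qed
  moreover have "((\<lambda>w. g w - g 0) has_field_derivative extremal_integrand lam mu z) (at z)"
    using g[OF z] z by (auto intro!: derivative_eq_intros simp: at_within_open[of z unit_disc])
  ultimately show ?thesis
    using z by (auto intro: has_field_derivative_transform_within_open[where S = unit_disc])
qed

lemma extremal_fun_holomorphic: "extremal_fun lam mu holomorphic_on unit_disc"
  by (subst holomorphic_on_open) (auto intro: extremal_fun_derivative)

lemma extremal_fun_odd:
  assumes z: "z \<in> unit_disc"
  shows "extremal_fun lam mu (- z) = - extremal_fun lam mu z"
proof -
  have d: "((\<lambda>w. extremal_fun lam mu (- w) + extremal_fun lam mu w) has_field_derivative 0) (at w within unit_disc)"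
    if w: "w \<in> unit_disc" for w
  proof -
    have "- w \<in> unit_disc" using w by simp
    from DERIV_chain2[OF extremal_fun_derivative[OF this] DERIV_minus[OF DERIV_ident]]
    have "((\<lambda>w. extremal_fun lam mu (- w)) has_field_derivative - extremal_integrand lam mu w) (at w)"
      by (simp add: extremal_integrand_def)
    from DERIV_add[OF this extremal_fun_derivative[OF w, of lam mu]] show ?thesis
      by (simp add: has_field_derivative_at_within)
  qed
  obtain c where c: "\<And>w. w \<in> unit_disc \<Longrightarrow> extremal_fun lam mu (- w) + extremal_fun lam mu w = c"
    using has_field_derivative_zero_constant[OF convex_ball d] by blast
  have "extremal_fun lam mu 0 = 0" by (simp add: extremal_fun_def)
  with c[of 0] have "c = 0" by simp
  with c[OF z] show ?thesis by (simp add: eq_neg_iff_add_eq_0)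
qed

lemma extremal_fun_deriv:
  "z \<in> unit_disc \<Longrightarrow> deriv (extremal_fun lam mu) z = extremal_integrand lam mu z"
  by (rule DERIV_imp_deriv[OF extremal_fun_derivative])

text \<open>The pre-Schwarzian is twice the slope \<open>U\<close>, and \<open>2 U' - (2 U)\<^sup>2 / 2 = 2 p\<close> by the Riccati equation.\<close>

lemma schwarzian_extremal_fun:
  assumes z: "z \<in> unit_disc"
  shows "schwarzian (extremal_fun lam mu) z = 2 * nehari_p lam mu z"
proof -
  have dd: "deriv (deriv (extremal_fun lam mu)) w = 2 * nehari_slope lam mu w * extremal_integrand lam mu w"
    if w: "w \<in> unit_disc" for w
  proof (rule DERIV_imp_deriv)
    show "(deriv (extremal_fun lam mu) has_field_derivative
        2 * nehari_slope lam mu w * extremal_integrand lam mu w) (at w)"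
      by (rule has_field_derivative_transform_within_open[OF extremal_integrand_derivative[OF w],
            where S = unit_disc]) (use w extremal_fun_deriv in auto)
  qed
  have quot: "deriv (deriv (extremal_fun lam mu)) w / deriv (extremal_fun lam mu) w = 2 * nehari_slope lam mu w"
    if "w \<in> unit_disc" for w
    using dd[OF that] extremal_fun_deriv[OF that] extremal_integrand_nonzero[OF that] by simp
  have "((\<lambda>w. 2 * nehari_slope lam mu w) has_field_derivative
      2 * (nehari_p lam mu z + (nehari_slope lam mu z)\<^sup>2)) (at z)"
    using complex_disc_nonzero[OF z] by (intro DERIV_cmult nehari_slope_derivative) auto
  then have "((\<lambda>w. deriv (deriv (extremal_fun lam mu)) w / deriv (extremal_fun lam mu) w)
      has_field_derivative 2 * (nehari_p lam mu z + (nehari_slope lam mu z)\<^sup>2)) (at z)"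
    by (rule has_field_derivative_transform_within_open[where S = unit_disc]) (use z quot in auto)
  then show ?thesis
    using quot[OF z] by (simp add: schwarzian_def DERIV_imp_deriv power_mult_distrib)
qed

section \<open>Sharpness\<close>

lemma nehari_p_holomorphic: "nehari_p lam mu holomorphic_on unit_disc"
proof -
  have "(\<lambda>z::complex. sin (of_real pi * z / 2) / cos (of_real pi * z / 2)) holomorphic_on unit_disc"
    using complex_disc_nonzero by (intro holomorphic_intros) auto
  then have t: "(\<lambda>z::complex. tan (of_real pi * z / 2)) holomorphic_on unit_disc"
    by (simp add: tan_def)
  show ?thesis
    unfolding nehari_p_def[abs_def] using complex_disc_nonzero
    by (intro holomorphic_intros t) auto
qed

lemma schwarzian_holomorphic:
  assumes f: "f holomorphic_on unit_disc" and f': "\<And>z. z \<in> unit_disc \<Longrightarrow> deriv f z \<noteq> 0"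
  shows "schwarzian f holomorphic_on unit_disc"
proof -
  have q: "(\<lambda>w. deriv (deriv f) w / deriv f w) holomorphic_on unit_disc"
    using f f' by (intro holomorphic_intros holomorphic_deriv) auto
  show ?thesis
    unfolding schwarzian_def[abs_def] by (intro holomorphic_intros holomorphic_deriv q) auto
qed

text \<open>Uniqueness for the initial value problem, in the form in which it is used below: the Wronskian of
  \<open>D\<close> with any other solution \<open>w\<close> is constant.\<close>

lemma wronskian_vanishes:
  fixes D D1 w w1 q :: "real \<Rightarrow> complex"
  assumes d: "\<And>t. \<bar>t\<bar> < 1 \<Longrightarrow> (D has_vector_derivative D1 t) (at t)"
    "\<And>t. \<bar>t\<bar> < 1 \<Longrightarrow> (D1 has_vector_derivative - q t * D t) (at t)"
    "\<And>t. \<bar>t\<bar> < 1 \<Longrightarrow> (w has_vector_derivative w1 t) (at t)"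
    "\<And>t. \<bar>t\<bar> < 1 \<Longrightarrow> (w1 has_vector_derivative - q t * w t) (at t)"
    and x0: "\<bar>x0\<bar> < 1" "D x0 = 0" "D1 x0 = 0" and t: "\<bar>t\<bar> < 1"
  shows "D t * w1 t = D1 t * w t"
proof -
  have "((\<lambda>t. D t * w1 t - D1 t * w t) has_vector_derivative 0) (at t within {-1<..<1})"
    if "t \<in> {-1<..<1}" for t
  proof -
    have t: "\<bar>t\<bar> < 1" using that by auto
    have "((\<lambda>t. D t * w1 t - D1 t * w t) has_vector_derivative
        (D t * (- q t * w t) + D1 t * w1 t) - (D1 t * w1 t + (- q t * D t) * w t)) (at t)"
      by (intro has_vector_derivative_diff has_vector_derivative_mult d t)
    then show ?thesis
      by (simp add: algebra_simps has_vector_derivative_at_within)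
  qed
  then obtain c where c: "\<And>t. t \<in> {-1<..<1} \<Longrightarrow> D t * w1 t - D1 t * w t = c"
    using has_vector_derivative_zero_constant[of "{-1<..<1::real}"] by auto
  have "c = 0" using c[of x0] x0 by (auto simp: abs_less_iff)
  with c[of t] t show ?thesis by (auto simp: abs_less_iff)
qed

text \<open>Start the solution \<open>u\<close> of \<open>u'' = - (Sf/2) u\<close> at \<open>x0\<close> with the logarithmic derivative of the
  weight. Since \<open>Sf\<close> is real on the axis, so is \<open>u\<close>, and the second comparison gives a zero to the right
  of \<open>x0\<close> and, after the reflection \<open>t \<mapsto> - t\<close>, one to the left. As \<open>u = (A + B f) v\<close>, the values of \<open>f\<close>
  at the two zeros coincide.\<close>

lemma not_univalent_if_schwarzian_large:
  assumes f: "f holomorphic_on unit_disc" and f': "\<And>z. z \<in> unit_disc \<Longrightarrow> deriv f z \<noteq> 0"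
    and par: "lam \<ge> 0" "mu \<ge> 0" "1 / 2 \<le> lam + mu"
    and S: "\<And>x::real. \<bar>x\<bar> < 1 \<Longrightarrow> schwarzian f (of_real x) \<in> \<real>"
      "\<And>x::real. \<bar>x\<bar> < 1 \<Longrightarrow> 2 * nehari_p lam mu x \<le> Re (schwarzian f (of_real x))"
    and x0: "\<bar>x0\<bar> < 1" "2 * nehari_p lam mu x0 < Re (schwarzian f (of_real x0))"
  shows "\<not> inj_on f unit_disc"
proof
  assume inj: "inj_on f unit_disc"
  obtain v v1 where
    v: "\<And>z. z \<in> unit_disc \<Longrightarrow> v z \<noteq> 0 \<and> deriv f z = 1 / (v z)\<^sup>2"
    "\<And>z. z \<in> unit_disc \<Longrightarrow> (v has_field_derivative v1 z) (at z)"
    "\<And>z. z \<in> unit_disc \<Longrightarrow> (v1 has_field_derivative - (schwarzian f z / 2) * v z) (at z)"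
    using schwarzian_linear_equation[OF f f'] by metis
  define q where "q t = Re (schwarzian f (of_real t)) / 2" for t
  have q: "schwarzian f (of_real t) / 2 = of_real (q t)" if "\<bar>t\<bar> < 1" for t
    using S(1)[OF that] by (simp add: q_def complex_is_Real_iff complex_eq_iff)
  define w where "w A B = (\<lambda>t. (A + B * f (of_real t)) * v (of_real t))" for A B
  define w1 where "w1 A B = (\<lambda>t. B / v (of_real t) + (A + B * f (of_real t)) * v1 (of_real t))" for A B
  have dw: "(w A B has_vector_derivative w1 A B t) (at t)"
    "(w1 A B has_vector_derivative - of_real (q t) * w A B t) (at t)" if t: "\<bar>t\<bar> < 1" for A B t
  proof -
    have z: "of_real t \<in> unit_disc" using t by simp
    note sol = schwarzian_solutions[OF f _ _ v(2)[OF z] v(3)[OF z] z, where A = A and B = B]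
    show "(w A B has_vector_derivative w1 A B t) (at t)"
      unfolding w_def w1_def using v(1)[OF z] by (intro has_vector_derivative_real_field sol) auto
    show "(w1 A B has_vector_derivative - of_real (q t) * w A B t) (at t)"
      unfolding w_def w1_def q[OF t, symmetric] using v(1)[OF z]
      by (intro has_vector_derivative_real_field sol) auto
  qed
  define v0 v10 f0 where "v0 = v (of_real x0)" "v10 = v1 (of_real x0)" "f0 = f (of_real x0)"
  note at_x0 = this
  have v0: "v0 \<noteq> 0" using v(1)[of "of_real x0"] x0 by (simp add: at_x0)
  define B where "B = v0 * (- of_real (nehari_slope lam mu x0) - v10 / v0)"
  define A where "A = 1 / v0 - B * f0"
  have ini: "w A B x0 = 1" "w1 A B x0 = - of_real (nehari_slope lam mu x0)"
    using v0 by (simp_all add: w_def w1_def A_def B_def flip: at_x0)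
  \<comment> \<open>\<open>D\<close> is a solution with zero initial data; it vanishes, so \<open>u\<close> is real.\<close>
  define D where "D = (\<lambda>t. w A B t - cnj (w A B t))"
  define D1 where "D1 = (\<lambda>t. w1 A B t - cnj (w1 A B t))"
  have dD: "(D has_vector_derivative D1 t) (at t)"
    "(D1 has_vector_derivative - of_real (q t) * D t) (at t)" if t: "\<bar>t\<bar> < 1" for t
  proof -
    show "(D has_vector_derivative D1 t) (at t)"
      unfolding D_def D1_def by (intro has_vector_derivative_diff has_vector_derivative_cnj dw t)
    have "(D1 has_vector_derivative - of_real (q t) * w A B t - cnj (- of_real (q t) * w A B t)) (at t)"
      unfolding D1_def by (intro has_vector_derivative_diff has_vector_derivative_cnj dw t)
    then show "(D1 has_vector_derivative - of_real (q t) * D t) (at t)"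
      by (simp add: D_def algebra_simps)
  qed
  have real: "D t = 0" if t: "\<bar>t\<bar> < 1" for t
  proof -
    have D0: "D x0 = 0" "D1 x0 = 0" by (simp_all add: D_def D1_def ini)
    have W: "D t * w1 a b t = D1 t * w a b t" for a b
      by (rule wronskian_vanishes[OF dD dw x0(1) D0 t])
    have nz: "v (of_real t) \<noteq> 0" using v(1)[of "of_real t"] t by simp
    have "D t * (1 / v (of_real t)) = f (of_real t) * (D1 t * v (of_real t) - D t * v1 (of_real t))"
      using W[of 0 1] by (simp add: w_def w1_def algebra_simps)
    also have "\<dots> = 0"
      using W[of 1 0] by (simp add: w_def w1_def)
    finally have "D t * (1 / v (of_real t)) = 0" .
    then show ?thesis using nz by simp
  qed
  define u u1 where "u t = Re (w A B t)" "u1 t = Re (w1 A B t)" for t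
  note u_defs = this
  have w_u: "w A B t = of_real (u t)" if "\<bar>t\<bar> < 1" for t
    using real[OF that] by (simp add: D_def u_defs complex_eq_iff)
  have du: "(u has_field_derivative u1 t) (at t)" "(u1 has_field_derivative - q t * u t) (at t)"
    if t: "\<bar>t\<bar> < 1" for t
    using dw[OF t, of A B] by (simp_all add: has_vector_derivative_complex_iff u_defs[abs_def])
  define C where "C = (2 powr lam * (pi / 2) powr mu)\<^sup>2"
  have C: "C > 0" by (simp add: C_def)
  have u0: "u x0 = 1" "u1 x0 = - nehari_slope lam mu x0" using ini by (simp_all add: u_defs)
  have pq: "nehari_p lam mu t \<le> q t" if "\<bar>t\<bar> < 1" for t
    using S(2)[OF that] by (simp add: q_def)
  have "\<exists>x\<in>{x0<..<1}. u x = 0"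
  proof (rule comparison_forces_zero[where p = "nehari_p lam mu" and q = q and C = C
      and U = "nehari_slope lam mu" and y = "nehari_weight lam mu" and u = u and ?u1.0 = u1])
    show "nehari_p lam mu x0 < q x0" using x0 by (simp add: q_def)
  qed (use x0 C u0 du pq nehari_slope_derivative_real nehari_weight_derivative nehari_weight_pos
      nehari_weight_square_le[OF par] in \<open>auto simp: C_def abs_less_iff\<close>)
  then obtain x2 where x2: "x0 < x2" "x2 < 1" "u x2 = 0" by auto
  have du': "((\<lambda>t. u (- t)) has_field_derivative - u1 (- t)) (at t)"
    "((\<lambda>t. - u1 (- t)) has_field_derivative - q (- t) * u (- t)) (at t)" if "\<bar>t\<bar> < 1" for t
  proof -
    have t: "\<bar>- t\<bar> < 1" using that by simp
    show "((\<lambda>t. u (- t)) has_field_derivative - u1 (- t)) (at t)"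
      using DERIV_chain2[OF du(1)[OF t] DERIV_minus[OF DERIV_ident]] by simp
    show "((\<lambda>t. - u1 (- t)) has_field_derivative - q (- t) * u (- t)) (at t)"
      using DERIV_minus[OF DERIV_chain2[OF du(2)[OF t] DERIV_minus[OF DERIV_ident]]] by simp
  qed
  have odd: "nehari_slope lam mu (- x) = - nehari_slope lam mu x" for x :: real
    by (simp add: nehari_slope_def)
  have "\<exists>x\<in>{- x0<..<1}. u (- x) = 0"
  proof (rule comparison_forces_zero[where p = "nehari_p lam mu" and q = "\<lambda>t. q (- t)" and C = C
      and U = "nehari_slope lam mu" and y = "nehari_weight lam mu"
      and u = "\<lambda>t. u (- t)" and ?u1.0 = "\<lambda>t. - u1 (- t)"])
    show "nehari_p lam mu (- x0) < q (- (- x0))" using x0 by (simp add: q_def nehari_p_even)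
    show "nehari_p lam mu t \<le> q (- t)" if "t \<in> {- x0..<1}" for t
      using pq[of "- t"] that x0 by (simp add: nehari_p_even abs_less_iff)
  qed (use x0 C u0 du' odd nehari_slope_derivative_real nehari_weight_derivative nehari_weight_pos
      nehari_weight_square_le[OF par] in \<open>auto simp: C_def abs_less_iff\<close>)
  then obtain x1 where x1: "x1 < x0" "-1 < x1" "u x1 = 0" by force
  have zero: "A + B * f (of_real x) = 0" if "\<bar>x\<bar> < 1" "u x = 0" for x
    using w_u[OF that(1)] that v(1)[of "of_real x"] by (simp add: w_def)
  have x12: "\<bar>x1\<bar> < 1" "\<bar>x2\<bar> < 1" using x0 x1 x2 by auto
  have "B * f (of_real x1) = B * f (of_real x2)"
    using zero[OF x12(1) x1(3)] zero[OF x12(2) x2(3)] by (metis add_left_cancel)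
  moreover have "f (of_real x1) \<noteq> f (of_real x2)"
    using inj x12 x1 x2 by (auto dest!: inj_onD)
  ultimately have "B = 0" by simp
  with zero[OF x12(1) x1(3)] ini(1) show False by (simp add: w_def)
qed

text \<open>Equality on the whole real interval would spread to the disc by the identity theorem.\<close>

lemma schwarzian_strictly_larger_somewhere:
  assumes f: "f holomorphic_on unit_disc" and f': "\<And>z. z \<in> unit_disc \<Longrightarrow> deriv f z \<noteq> 0"
    and S: "\<And>x::real. \<bar>x\<bar> < 1 \<Longrightarrow> schwarzian f (of_real x) \<in> \<real>"
      "\<And>x::real. \<bar>x\<bar> < 1 \<Longrightarrow> 2 * nehari_p lam mu x \<le> Re (schwarzian f (of_real x))"
    and ne: "z \<in> unit_disc" "schwarzian f z \<noteq> 2 * nehari_p lam mu z"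
  shows "\<exists>x::real. \<bar>x\<bar> < 1 \<and> 2 * nehari_p lam mu x < Re (schwarzian f (of_real x))"
proof (rule ccontr)
  assume "\<not> ?thesis"
  then have eq: "Re (schwarzian f (of_real x)) = 2 * nehari_p lam mu x" if "\<bar>x\<bar> < 1" for x
    using S(2)[OF that] that by force
  have "schwarzian f z - 2 * nehari_p lam mu z = 0"
  proof (rule analytic_continuation[of "\<lambda>z. schwarzian f z - 2 * nehari_p lam mu z" unit_disc
        "of_real ` {-1<..<1}" 0])
    show "(\<lambda>z. schwarzian f z - 2 * nehari_p lam mu z) holomorphic_on unit_disc"
      by (intro holomorphic_intros schwarzian_holomorphic nehari_p_holomorphic f f')
    show "0 islimpt (of_real ` {-1<..<1} :: complex set)"
      unfolding islimpt_approachable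
    proof safe
      fix e :: real assume "e > 0"
      then show "\<exists>x'\<in>of_real ` {- 1<..<1}. x' \<noteq> (0::complex) \<and> dist x' 0 < e"
        by (intro bexI[of _ "of_real (min (e / 2) (1 / 2))"] imageI) auto
    qed
    show "schwarzian f w - 2 * nehari_p lam mu w = 0" if "w \<in> of_real ` {-1<..<1}" for w
    proof -
      obtain x where x: "w = of_real x" "\<bar>x\<bar> < 1" using \<open>w \<in> _\<close> by auto
      show ?thesis
        using S(1)[OF x(2)] eq[OF x(2)] unfolding x(1) nehari_p_of_real
        by (simp add: complex_eq_iff complex_is_Real_iff)
    qed
  qed (use ne in auto)
  with ne show False by simp
qed

section \<open>The theorem\<close>

theorem theorem2:
  fixes lam mu :: real
  assumes "lam \<ge> 0" and "mu \<ge> 0"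
    and "1 / 2 \<le> lam + mu" and "lam + mu \<le> 1"
    and "(1 - mu) / 2 \<le> lam" and "lam \<le> 1 - mu"
  shows "(\<forall>f. f holomorphic_on unit_disc \<and> locally_univalent_on f unit_disc \<and>
              univalence_bound lam mu f \<longrightarrow> inj_on f unit_disc)
       \<and> (extremal_fun lam mu holomorphic_on unit_disc
          \<and> (\<forall>z\<in>unit_disc. extremal_fun lam mu (- z) = - extremal_fun lam mu z)
          \<and> inj_on (extremal_fun lam mu) unit_disc)
       \<and> sharp_criterion lam mu"
proof (intro conjI allI impI ballI)
  fix f assume "f holomorphic_on unit_disc \<and> locally_univalent_on f unit_disc \<and> univalence_bound lam mu f"
  then show "inj_on f unit_disc"
    using locally_univalent_deriv_nonzero assms by (intro nehari_criterion[of f lam mu]) blast+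
next
  show "extremal_fun lam mu holomorphic_on unit_disc"
    by (rule extremal_fun_holomorphic)
next
  fix z :: complex assume "z \<in> unit_disc"
  then show "extremal_fun lam mu (- z) = - extremal_fun lam mu z"
    by (rule extremal_fun_odd)
next
  have "univalence_bound lam mu (extremal_fun lam mu)"
    using norm_nehari_p_le[of _ lam mu] assms
    by (simp add: univalence_bound_def schwarzian_extremal_fun norm_mult)
  then show "inj_on (extremal_fun lam mu) unit_disc"
    using assms extremal_fun_deriv extremal_integrand_nonzero extremal_fun_holomorphic
    by (intro nehari_criterion[of _ lam mu]) auto
next
  show "sharp_criterion lam mu"
    unfolding sharp_criterion_def
  proof (intro allI impI, elim conjE bexE)
    fix f z
    assume f: "f holomorphic_on unit_disc" and loc: "locally_univalent_on f unit_disc"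
      and S: "\<forall>x::real. - 1 < x \<and> x < 1 \<longrightarrow> schwarzian f (of_real x) \<in> \<real> \<and>
             Re (schwarzian f (of_real x)) \<ge> 2 * nehari_p lam mu x"
      and ne: "z \<in> unit_disc" "schwarzian f z \<noteq> 2 * nehari_p lam mu z"
    note f' = locally_univalent_deriv_nonzero[OF f loc]
    have S1: "schwarzian f (of_real x) \<in> \<real>" if "\<bar>x\<bar> < 1" for x
      using S that by (auto simp: abs_less_iff)
    have S2: "2 * nehari_p lam mu x \<le> Re (schwarzian f (of_real x))" if "\<bar>x\<bar> < 1" for x
      using S that by (auto simp: abs_less_iff)
    obtain x0 where "\<bar>x0\<bar> < 1" "2 * nehari_p lam mu x0 < Re (schwarzian f (of_real x0))"
      using schwarzian_strictly_larger_somewhere[OF f f' S1 S2 ne] by blast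
    then show "\<not> inj_on f unit_disc"
      using not_univalent_if_schwarzian_large[OF f f' assms(1-3) S1 S2] by blast
  qed
qed

end
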